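(* Let $(\mathcal{S}^x,H)$ be a finite skew translation generalized quadrangle of order $(q,q)$, $q$ an odd power of the prime $p$ (i.e. $q$ odd), let $\mathbb{S}$ be its group of symmetries about $x$, and let $(\mathcal{F},\mathcal{F}^* )$ be the associated Kantor family (with respect to any point not collinear with $x$). The following are equivalent: (i) the members of $\mathcal{F}^*$ are abelian; (ii) $\mathcal{S}$ satisfies $(M)_x$; (iii) $H$ is a special group of exponent $p$; (iv) $\mathbb{S}\le Z(H)$; (v) $\mathbb{S}=Z(H)$.
   Context: A finite generalized quadrangle (GQ) of order $(s,t)$: every line has $s+1$ points, every point is on $t+1$ lines, two points are on at most one common line, and for each point $p$ not on a line $L$ there is a unique point of $L$ collinear with $p$, denoted $\mathrm{proj}_Lp$. An elation generalized quadrangle $(\mathcal{S}^x,H)$: $H\le\mathrm{Aut}(\mathcal{S})$ fixes every line through $x$ and acts sharply transitively on the points not collinear with $x$. A symmetry about $x$ is an automorphism fixing every point collinear with $x$; the EGQ is a skew translation generalized quadrangle if $H$ contains a subgroup $\mathbb{S}$ of order $t$ of symmetries about $x$. Kantor family: for a point $z$ not collinear with $x$ with lines $U_0,\dots,U_t$ through it and $u_i=\mathrm{proj}_{U_i}x$, put $\mathcal{F}=\{H_{U_i}\}$ and $\mathcal{F}^*=\{H_{u_i}\}$ (stabilizers). Condition $(M)_x$: for every line $L$ through $x$, every point $y\neq x$ on $L$, and every line $M\neq L$ through $y$, the group of automorphisms of $\mathcal{S}$ fixing every line through $x$, every line through $y$ and every point of $L$ acts transitively on the points of $M$ different from $y$.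 A finite $p$-group $H$ is special if $Z(H)=[H,H]=\Phi(H)$ is elementary abelian ($\Phi$ the Frattini subgroup). *)

theory Defs
  imports "HOL-Algebra.Algebra"
begin

definition collinear :: "'p set \<Rightarrow> 'l set \<Rightarrow> ('p \<Rightarrow> 'l \<Rightarrow> bool) \<Rightarrow> 'p \<Rightarrow> 'p \<Rightarrow> bool" where
  "collinear P L I a b \<longleftrightarrow> a \<in> P \<and> b \<in> P \<and> (\<exists>m\<in>L. I a m \<and> I b m)"

definition is_GQ :: "'p set \<Rightarrow> 'l set \<Rightarrow> ('p \<Rightarrow> 'l \<Rightarrow> bool) \<Rightarrow> nat \<Rightarrow> nat \<Rightarrow> bool" where
  "is_GQ P L I s t \<longleftrightarrow>
     finite P \<and> finite L \<and>
     (\<forall>l\<in>L. card {a\<in>P. I a l} = s + 1) \<and>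
     (\<forall>a\<in>P. card {l\<in>L. I a l} = t + 1) \<and>
     (\<forall>a\<in>P. \<forall>b\<in>P. a \<noteq> b \<longrightarrow> card {l\<in>L. I a l \<and> I b l} \<le> 1) \<and>
     (\<forall>a\<in>P. \<forall>l\<in>L. \<not> I a l \<longrightarrow> (\<exists>!b. b \<in> P \<and> I b l \<and> collinear P L I a b))"

text \<open>Projection of a point a onto a line l (a not on l).\<close>
definition proj :: "'p set \<Rightarrow> 'l set \<Rightarrow> ('p \<Rightarrow> 'l \<Rightarrow> bool) \<Rightarrow> 'l \<Rightarrow> 'p \<Rightarrow> 'p" where
  "proj P L I l a = (THE b. b \<in> P \<and> I b l \<and> collinear P L I a b)"

type_synonym ('p,'l) autom = "('p \<Rightarrow> 'p) \<times> ('l \<Rightarrow> 'l)"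

definition Aut :: "'p set \<Rightarrow> 'l set \<Rightarrow> ('p \<Rightarrow> 'l \<Rightarrow> bool) \<Rightarrow> ('p,'l) autom set" where
  "Aut P L I = {(f, g). bij_betw f P P \<and> (\<forall>a. a \<notin> P \<longrightarrow> f a = a) \<and>
                      bij_betw g L L \<and> (\<forall>l. l \<notin> L \<longrightarrow> g l = l) \<and>
                      (\<forall>a\<in>P. \<forall>l\<in>L. I a l \<longleftrightarrow> I (f a) (g l))}"

definition AutGroup :: "'p set \<Rightarrow> 'l set \<Rightarrow> ('p \<Rightarrow> 'l \<Rightarrow> bool) \<Rightarrow> ('p,'l) autom monoid" where
  "AutGroup P L I = \<lparr> carrier = Aut P L I,
                      monoid.mult = (\<lambda>h k. (fst h \<circ> fst k, snd h \<circ> snd k)),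
                      monoid.one = (id, id) \<rparr>"

definition is_EGQ :: "'p set \<Rightarrow> 'l set \<Rightarrow> ('p \<Rightarrow> 'l \<Rightarrow> bool) \<Rightarrow> nat \<Rightarrow> nat \<Rightarrow> 'p \<Rightarrow> ('p,'l) autom set \<Rightarrow> bool" where
  "is_EGQ P L I s t x H \<longleftrightarrow>
     is_GQ P L I s t \<and> x \<in> P \<and> subgroup H (AutGroup P L I) \<and>
     (\<forall>h\<in>H. \<forall>l\<in>L. I x l \<longrightarrow> snd h l = l) \<and>
     (\<forall>a\<in>P. \<forall>b\<in>P. \<not> collinear P L I x a \<longrightarrow> \<not> collinear P L I x b \<longrightarrow>
        (\<exists>!h. h \<in> H \<and> fst h a = b))"

definition is_symmetry :: "'p set \<Rightarrow> 'l set \<Rightarrow> ('p \<Rightarrow> 'l \<Rightarrow> bool) \<Rightarrow> 'p \<Rightarrow> ('p,'l) autom \<Rightarrow> bool" where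
  "is_symmetry P L I x h \<longleftrightarrow> h \<in> Aut P L I \<and> (\<forall>a\<in>P. collinear P L I x a \<longrightarrow> fst h a = a)"

definition is_STGQ :: "'p set \<Rightarrow> 'l set \<Rightarrow> ('p \<Rightarrow> 'l \<Rightarrow> bool) \<Rightarrow> nat \<Rightarrow> nat \<Rightarrow> 'p \<Rightarrow> ('p,'l) autom set
                        \<Rightarrow> ('p,'l) autom set \<Rightarrow> bool" where
  "is_STGQ P L I s t x H S \<longleftrightarrow>
     is_EGQ P L I s t x H \<and> S \<subseteq> H \<and> subgroup S (AutGroup P L I) \<and> card S = t \<and>
     (\<forall>h\<in>S. is_symmetry P L I x h)"

definition stab_pt :: "('p,'l) autom set \<Rightarrow> 'p \<Rightarrow> ('p,'l) autom set" where
  "stab_pt H a = {h\<in>H. fst h a = a}"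

definition stab_line :: "('p,'l) autom set \<Rightarrow> 'l \<Rightarrow> ('p,'l) autom set" where
  "stab_line H l = {h\<in>H. snd h l = l}"

definition kantor_F :: "'p set \<Rightarrow> 'l set \<Rightarrow> ('p \<Rightarrow> 'l \<Rightarrow> bool) \<Rightarrow> 'p \<Rightarrow> ('p,'l) autom set \<Rightarrow> 'p
                        \<Rightarrow> ('p,'l) autom set set" where
  "kantor_F P L I x H z = {stab_line H U | U. U \<in> L \<and> I z U}"

definition kantor_Fstar :: "'p set \<Rightarrow> 'l set \<Rightarrow> ('p \<Rightarrow> 'l \<Rightarrow> bool) \<Rightarrow> 'p \<Rightarrow> ('p,'l) autom set \<Rightarrow> 'p
                        \<Rightarrow> ('p,'l) autom set set" where
  "kantor_Fstar P L I x H z = {stab_pt H (proj P L I U x) | U. U \<in> L \<and> I z U}"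

definition condM :: "'p set \<Rightarrow> 'l set \<Rightarrow> ('p \<Rightarrow> 'l \<Rightarrow> bool) \<Rightarrow> 'p \<Rightarrow> bool" where
  "condM P L I x \<longleftrightarrow>
     (\<forall>K\<in>L. I x K \<longrightarrow> (\<forall>y\<in>P. I y K \<longrightarrow> y \<noteq> x \<longrightarrow> (\<forall>M\<in>L. M \<noteq> K \<longrightarrow> I y M \<longrightarrow>
        (let G = {h\<in>Aut P L I. (\<forall>l\<in>L. I x l \<longrightarrow> snd h l = l) \<and>
                               (\<forall>l\<in>L. I y l \<longrightarrow> snd h l = l) \<and>
                               (\<forall>a\<in>P. I a K \<longrightarrow> fst h a = a)}
         in \<forall>a\<in>P. \<forall>b\<in>P. I a M \<longrightarrow> a \<noteq> y \<longrightarrow> I b M \<longrightarrow> b \<noteq> y \<longrightarrow>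
              (\<exists>h\<in>G. fst h a = b)))))"

definition center :: "('a, 'b) monoid_scheme \<Rightarrow> 'a set" where
  "center G = {z \<in> carrier G. \<forall>g\<in>carrier G. z \<otimes>\<^bsub>G\<^esub> g = g \<otimes>\<^bsub>G\<^esub> z}"

definition maximal_subgroup :: "('a, 'b) monoid_scheme \<Rightarrow> 'a set \<Rightarrow> bool" where
  "maximal_subgroup G M \<longleftrightarrow> subgroup M G \<and> M \<noteq> carrier G \<and>
     (\<forall>K. subgroup K G \<longrightarrow> M \<subseteq> K \<longrightarrow> K = M \<or> K = carrier G)"

text \<open>Frattini subgroup: intersection of all maximal subgroups (the whole group if none).\<close>
definition frattini :: "('a, 'b) monoid_scheme \<Rightarrow> 'a set" where
  "frattini G = carrier G \<inter> \<Inter> {M. maximal_subgroup G M}"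

definition p_group :: "nat \<Rightarrow> ('a, 'b) monoid_scheme \<Rightarrow> bool" where
  "p_group p G \<longleftrightarrow> group G \<and> finite (carrier G) \<and> (\<exists>n. card (carrier G) = p ^ n)"

definition elementary_abelian :: "nat \<Rightarrow> ('a, 'b) monoid_scheme \<Rightarrow> 'a set \<Rightarrow> bool" where
  "elementary_abelian p G A \<longleftrightarrow> comm_group (G\<lparr>carrier := A\<rparr>) \<and>
     (\<forall>a\<in>A. a [^]\<^bsub>G\<^esub> p = \<one>\<^bsub>G\<^esub>)"

definition special_group :: "nat \<Rightarrow> ('a, 'b) monoid_scheme \<Rightarrow> bool" where
  "special_group p G \<longleftrightarrow> p_group p G \<and>
     center G = derived G (carrier G) \<and> derived G (carrier G) = frattini G \<and>
     elementary_abelian p G (center G)"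

definition group_exponent :: "('a, 'b) monoid_scheme \<Rightarrow> nat" where
  "group_exponent G = (LEAST n. 0 < n \<and> (\<forall>g\<in>carrier G. g [^]\<^bsub>G\<^esub> n = \<one>\<^bsub>G\<^esub>))"

end

theory Submission
  imports Defs
begin

text \<open>
  Let \<open>A\<^sub>U\<close> be the stabilizer in \<open>H\<close> of a line \<open>U\<close> on \<open>z\<close>. The symmetry group \<open>S\<close> is normal in \<open>H\<close>, the
  stabilizer of \<open>proj\<^sub>U x\<close> is \<open>A\<^sub>U S\<close>, and these \<open>q + 1\<close> groups induce a partition of \<open>H / S\<close>, which is
  therefore elementary abelian.

  The heart of the matter is a parity argument. Fix \<open>1 \<noteq> h \<in> A\<^sub>0\<close>. For distinct \<open>i, j \<noteq> 0\<close> there is a unique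
  \<open>\<sigma> i j \<in> S\<close> with \<open>h \<in> A\<^sub>i A\<^sub>j (\<sigma> i j)\<close>, and for fixed \<open>i\<close> the map \<open>j \<mapsto> \<sigma> i j\<close> is a bijection onto
  \<open>S - {1}\<close>. If \<open>h\<close> and \<open>S\<close> were central modulo a proper subgroup \<open>D\<close> of \<open>S\<close>, then \<open>\<sigma> i j\<close> and \<open>\<sigma> j i\<close> would
  agree modulo \<open>D\<close>; for a nontrivial coset of \<open>D\<close> this would give a symmetric irreflexive relation
  with \<open>q |D|\<close> elements, an odd number. With \<open>D = [H, H]\<close> this shows \<open>[H, H] = S\<close>, and with \<open>D = 1\<close> it shows
  that \<open>S = Z(H)\<close> as soon as \<open>S \<le> Z(H)\<close>. All five conditions turn out to be equivalent to \<open>S \<le> Z(H)\<close>.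

  For \<open>(M)\<^sub>x\<close>, the point is that \<open>S\<close> commutes with \<open>A\<^sub>U\<close> iff \<open>A\<^sub>U\<close> fixes every line on \<open>proj\<^sub>U x\<close>, because \<open>S\<close> is
  transitive on the lines on \<open>proj\<^sub>U x\<close> other than the one through \<open>x\<close>.
\<close>

section \<open>Groups with a skew translation Kantor family\<close>

text \<open>Irreflexivity makes \<open>(a, b)\<close> and \<open>(b, a)\<close> two different
  elements, so the induction always removes exactly two.\<close>

lemma even_card_sym_irrefl:
  assumes "finite R" "sym R" "irrefl R"
  shows "even (card R)"
  using assms
proof (induction R rule: finite_psubset_induct)
  case (psubset R)
  show ?case
  proof (cases "R = {}")
    case False
    then obtain a b where ab: "(a, b) \<in> R" by auto
    then have ba: "(b, a) \<in> R" and ne: "a \<noteq> b"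
      using psubset.prems by (auto dest: symD simp: irrefl_def)
    let ?R = "R - {(a, b), (b, a)}"
    have "sym ?R" "irrefl ?R"
      using psubset.prems by (auto simp: sym_def irrefl_def)
    moreover have "?R \<subset> R" using ab by auto
    ultimately have "even (card ?R)" using psubset.IH by blast
    moreover have "card R = card ?R + card {(a, b), (b, a)}"
      using psubset.hyps ab ba
      by (metis card_Diff_subset card_mono empty_subsetI finite.emptyI finite_insert insert_subset
          le_add_diff_inverse2)
    ultimately show ?thesis using ne by simp
  qed simp
qed

section \<open>Calculation with group words and subgroups\<close>

context group
begin

lemma inv_cancel_left: "\<lbrakk>a \<in> carrier G; x \<in> carrier G\<rbrakk> \<Longrightarrow> inv a \<otimes> (a \<otimes> x) = x"
  by (simp add: m_assoc[symmetric])

lemma cancel_inv_left: "\<lbrakk>a \<in> carrier G; x \<in> carrier G\<rbrakk> \<Longrightarrow> a \<otimes> (inv a \<otimes> x) = x"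
  by (simp add: m_assoc[symmetric])

text \<open>Rewrites group words to right-associated form with adjacent inverses cancelled; the
  commutator identities below are verified in this way.\<close>

lemmas word_simps = m_assoc inv_mult_group inv_cancel_left cancel_inv_left

lemma subgroup_closed:
  assumes "subgroup K G"
  shows "K \<subseteq> carrier G" "\<one> \<in> K" "\<And>a b. \<lbrakk>a \<in> K; b \<in> K\<rbrakk> \<Longrightarrow> a \<otimes> b \<in> K"
    "\<And>a. a \<in> K \<Longrightarrow> inv a \<in> K" "\<And>a. a \<in> K \<Longrightarrow> a \<in> carrier G"
  using subgroup.subset[OF assms] subgroup.one_closed[OF assms] subgroup.m_closed[OF assms]
    subgroup.m_inv_closed[OF assms] by auto

lemma subgroup_nat_pow_closed:
  assumes "subgroup K G" "a \<in> K"
  shows "a [^] (n::nat) \<in> K"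
  using subgroup_closed[OF assms(1)] assms(2) by (induction n) auto

end

text \<open>\<open>K1\<close> and \<open>K2\<close> are Kantor's two conditions written out in
  elements: \<open>A i\<close> times \<open>A j\<close> meets \<open>A k\<close> trivially, and
  \<open>A i\<close> meets \<open>A j\<close> times \<open>S\<close> trivially. The order is only
  bounded from above; counting products \<open>a \<otimes> b \<otimes> s\<close> gives
  equality.\<close>

locale skew_kantor = group G for G (structure) +
  fixes J :: "'i set" and A :: "'i \<Rightarrow> 'a set" and S :: "'a set" and q :: nat
  assumes fin: "finite (carrier G)" and card_le: "card (carrier G) \<le> q ^ 3"
    and card_J: "card J = q + 1" and q_odd: "odd q" and q_gt: "q > 1"
    and S_normal: "S \<lhd> G" and card_S: "card S = q"
    and A_sub: "i \<in> J \<Longrightarrow> subgroup (A i) G" and card_A: "i \<in> J \<Longrightarrow> card (A i) = q"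
    and K2: "\<lbrakk>i \<in> J; j \<in> J; i \<noteq> j; a \<in> A i; b \<in> A j; s \<in> S; b \<otimes> s = a\<rbrakk> \<Longrightarrow> a = \<one>"
    and K1: "\<lbrakk>i \<in> J; j \<in> J; k \<in> J; i \<noteq> j; i \<noteq> k; j \<noteq> k; a \<in> A i; b \<in> A j; c \<in> A k;
              a \<otimes> b = c\<rbrakk> \<Longrightarrow> c = \<one>"
begin

lemma S_sub: "subgroup S G"
  using S_normal by (simp add: normal_imp_subgroup)

lemmas S_closed [simp] = subgroup_closed[OF S_sub]
lemmas A_closed [simp] = subgroup_closed[OF A_sub]

lemma S_conj: "\<lbrakk>g \<in> carrier G; s \<in> S\<rbrakk> \<Longrightarrow> g \<otimes> s \<otimes> inv g \<in> S"
  using S_normal normal_inv_iff by blast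

lemma S_conj': "\<lbrakk>g \<in> carrier G; s \<in> S\<rbrakk> \<Longrightarrow> inv g \<otimes> s \<otimes> g \<in> S"
  using S_conj[of "inv g" s] by simp

lemma fin_sub: "K \<subseteq> carrier G \<Longrightarrow> finite K"
  using fin finite_subset by blast

lemma finite_J: "finite J"
  using card_J card.infinite by fastforce

lemma ex_other: "i \<in> J \<Longrightarrow> \<exists>j\<in>J. j \<noteq> i"
proof -
  assume "i \<in> J"
  then have "card (J - {i}) = q" using card_J finite_J by simp
  then have "J - {i} \<noteq> {}" using q_gt by (metis card.empty not_less_zero)
  then show ?thesis by auto
qed

section \<open>Unique factorization through two members and \<open>S\<close>\<close>

lemma A_Int_S: "\<lbrakk>i \<in> J; a \<in> A i; a \<in> S\<rbrakk> \<Longrightarrow> a = \<one>"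
proof -
  assume i: "i \<in> J" and a: "a \<in> A i" "a \<in> S"
  obtain j where "j \<in> J" "j \<noteq> i" using ex_other i by auto
  then show "a = \<one>" using K2[of i j a \<one> a] i a by simp
qed

text \<open>Normality of \<open>S\<close> moves both factors from \<open>S\<close> to the right,
  which exhibits \<open>inv a' \<otimes> a\<close> as an element of \<open>A j\<close> times
  \<open>S\<close>; \<open>K2\<close> makes it trivial. The rest follows from the trivial
  intersection of \<open>A j\<close> and \<open>S\<close>.\<close>

lemma decomp_unique:
  assumes i: "i \<in> J" and j: "j \<in> J" and ne: "i \<noteq> j"
    and a: "a \<in> A i" "a' \<in> A i" and b: "b \<in> A j" "b' \<in> A j" and s: "s \<in> S" "s' \<in> S"
    and eq: "a \<otimes> b \<otimes> s = a' \<otimes> b' \<otimes> s'"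
  shows "a = a' \<and> b = b' \<and> s = s'"
proof -
  have c: "a \<in> carrier G" "a' \<in> carrier G" "b \<in> carrier G" "b' \<in> carrier G"
     "s \<in> carrier G" "s' \<in> carrier G" using i j a b s by auto
  define t where "t = b \<otimes> (s' \<otimes> inv s) \<otimes> inv b"
  have t: "t \<in> S" unfolding t_def using S_conj c s by simp
  have tc: "t \<in> carrier G" using t by simp
  have "a = a' \<otimes> b' \<otimes> s' \<otimes> inv s \<otimes> inv b"
    using eq[symmetric] c by (simp add: word_simps)
  then have "inv a' \<otimes> a = b' \<otimes> inv b \<otimes> t"
    using c by (simp add: word_simps t_def)
  moreover have "inv a' \<otimes> a \<in> A i" "b' \<otimes> inv b \<in> A j" using a b i j by auto
  ultimately have "inv a' \<otimes> a = \<one>" using K2[OF i j ne] t by metis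
  then have aa: "a = a'" using c by (metis inv_equality inv_inv inv_closed)
  then have bs: "b \<otimes> s = b' \<otimes> s'" using eq c by (simp add: m_assoc)
  then have "inv b' \<otimes> b = s' \<otimes> inv s"
    using c by (metis inv_closed inv_solve_left inv_solve_right m_assoc m_closed)
  moreover have "inv b' \<otimes> b \<in> A j" "s' \<otimes> inv s \<in> S" using b j s by auto
  ultimately have "inv b' \<otimes> b = \<one>" using A_Int_S[OF j] by metis
  then have "b = b'" using c by (metis inv_equality inv_inv inv_closed)
  then show ?thesis using aa bs c by simp
qed

text \<open>By uniqueness the \<open>q ^ 3\<close> triples give different products, and the assumed
  bound leaves no room for other elements.\<close>

lemma decomp_all:
  assumes i: "i \<in> J" and j: "j \<in> J" and ne: "i \<noteq> j"
  shows "card (carrier G) = q ^ 3" and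
    "(\<lambda>(a, b, s). a \<otimes> b \<otimes> s) ` (A i \<times> A j \<times> S) = carrier G"
proof -
  let ?f = "\<lambda>(a, b, s). a \<otimes> b \<otimes> s"
  have inj: "inj_on ?f (A i \<times> A j \<times> S)"
    using decomp_unique[OF assms] by (auto simp: inj_on_def)
  have "card (A i \<times> A j \<times> S) = q ^ 3"
    using i j by (simp add: card_cartesian_product card_A card_S power3_eq_cube)
  then have c: "card (?f ` (A i \<times> A j \<times> S)) = q ^ 3" using card_image[OF inj] by simp
  have sub: "?f ` (A i \<times> A j \<times> S) \<subseteq> carrier G" using i j by auto
  show "card (carrier G) = q ^ 3" using card_mono[OF fin sub] c card_le by simp
  then show "?f ` (A i \<times> A j \<times> S) = carrier G" using card_subset_eq[OF fin sub] c by simp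
qed

lemma decomp:
  assumes "i \<in> J" "j \<in> J" "i \<noteq> j" "g \<in> carrier G"
  shows "\<exists>a\<in>A i. \<exists>b\<in>A j. \<exists>s\<in>S. g = a \<otimes> b \<otimes> s"
proof -
  have "g \<in> (\<lambda>(a, b, s). a \<otimes> b \<otimes> s) ` (A i \<times> A j \<times> S)"
    using decomp_all(2)[OF assms(1-3)] assms(4) by simp
  then show ?thesis by force
qed

lemma order_G: "card (carrier G) = q ^ 3"
proof -
  have "J \<noteq> {}" using card_J by auto
  then obtain i where "i \<in> J" by auto
  then show ?thesis using ex_other decomp_all(1) by metis
qed

section \<open>The partition of \<open>G\<close> modulo \<open>S\<close> by the groups
  \<open>B i\<close>\<close>

definition B :: "'i \<Rightarrow> 'a set" where "B i = A i <#> S"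

lemma B_iff: "g \<in> B i \<longleftrightarrow> (\<exists>a\<in>A i. \<exists>s\<in>S. g = a \<otimes> s)"
  by (auto simp: B_def set_mult_def)

lemma B_sub: "i \<in> J \<Longrightarrow> subgroup (B i) G"
  unfolding B_def using mult_norm_subgroup[OF S_normal A_sub]
  by (simp add: commut_normal[OF A_sub S_normal, symmetric])

lemmas B_closed [simp] = subgroup_closed[OF B_sub]

lemma A_le_B: "i \<in> J \<Longrightarrow> a \<in> A i \<Longrightarrow> a \<in> B i"
  by (metis A_closed(5) B_iff S_closed(2) r_one)

lemma S_le_B: "i \<in> J \<Longrightarrow> s \<in> S \<Longrightarrow> s \<in> B i"
  by (metis A_closed(2) B_iff S_closed(5) l_one)

lemma B_Int_B:
  assumes "i \<in> J" "j \<in> J" "i \<noteq> j" "g \<in> B i" "g \<in> B j"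
  shows "g \<in> S"
proof -
  obtain a s where a: "a \<in> A i" "s \<in> S" "g = a \<otimes> s" using assms by (auto simp: B_iff)
  obtain b t where b: "b \<in> A j" "t \<in> S" "g = b \<otimes> t" using assms by (auto simp: B_iff)
  have c: "a \<in> carrier G" "b \<in> carrier G" "s \<in> carrier G" "t \<in> carrier G"
    using a b assms by auto
  have "b \<otimes> (t \<otimes> inv s) = a" using a(3) b(3) c by (metis inv_closed inv_solve_right m_assoc m_closed)
  moreover have "t \<otimes> inv s \<in> S" using a b by simp
  ultimately have "a = \<one>" using K2[OF assms(1-3) a(1) b(1)] by blast
  then show ?thesis using a c by simp
qed

text \<open>If no part contained \<open>g\<close>, its factorizations along a fixed \<open>i\<close>
  and varying \<open>j\<close> would have different first factors, since two equal ones put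
  \<open>g\<close> into \<open>A i\<close> times \<open>S\<close>. The \<open>q\<close> indices
  \<open>j\<close> then use up all \<open>q\<close> elements of \<open>A i\<close>, and the first
  factor \<open>\<one>\<close> puts \<open>g\<close> into a part after all.\<close>

lemma cover:
  assumes g: "g \<in> carrier G"
  shows "\<exists>i\<in>J. g \<in> B i"
proof (rule ccontr)
  assume no: "\<not> ?thesis"
  have "J \<noteq> {}" using card_J by auto
  then obtain i where i: "i \<in> J" by auto
  have "\<exists>a\<in>A i. inv a \<otimes> g \<in> B j" if "j \<in> J - {i}" for j
  proof -
    have j: "j \<in> J" "i \<noteq> j" using that by auto
    obtain a b s where d: "a \<in> A i" "b \<in> A j" "s \<in> S" "g = a \<otimes> b \<otimes> s"
      using decomp[OF i j g] by blast
    have "inv a \<otimes> g = b \<otimes> s" using d i j by (simp add: word_simps)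
    then show ?thesis using d by (auto simp: B_iff)
  qed
  then obtain f where f: "\<And>j. j \<in> J - {i} \<Longrightarrow> f j \<in> A i"
    "\<And>j. j \<in> J - {i} \<Longrightarrow> inv (f j) \<otimes> g \<in> B j" by metis
  have "inj_on f (J - {i})"
  proof (rule inj_onI, rule ccontr)
    fix j k assume jk: "j \<in> J - {i}" "k \<in> J - {i}" "f j = f k" "j \<noteq> k"
    then have "inv (f j) \<otimes> g \<in> S" using B_Int_B[of j k] f by fastforce
    then have "f j \<otimes> (inv (f j) \<otimes> g) \<in> B i" using f(1)[OF jk(1)] by (auto simp: B_iff)
    then have "g \<in> B i" using f(1)[OF jk(1)] g i by (simp add: cancel_inv_left)
    then show False using no i by auto
  qed
  then have "card (f ` (J - {i})) = card (A i)"
    using card_image i card_A card_J finite_J by fastforce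
  moreover have "f ` (J - {i}) \<subseteq> A i" using f(1) by auto
  ultimately have "f ` (J - {i}) = A i" using fin_sub[OF A_closed(1)[OF i]] card_subset_eq by blast
  then obtain j where "j \<in> J - {i}" "f j = \<one>" using i by (metis A_closed(2) imageE)
  then have "g \<in> B j" "j \<in> J" using f(2)[of j] g by auto
  then show False using no by auto
qed

text \<open>\<open>\<sigma> j\<close> is the factor in \<open>S\<close> of \<open>h\<close> factored
  along \<open>i\<close> and \<open>j\<close>; it is not \<open>\<one>\<close> because of
  \<open>K1\<close>. If it agreed for \<open>j\<close> and \<open>k\<close>, cancelling it and
  applying \<open>K1\<close> would put \<open>h\<close> into \<open>A i\<close> times
  \<open>S\<close>, against \<open>K2\<close>. Both sides have \<open>q - 1\<close> elements, so
  injectivity is enough.\<close>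

lemma twist_bij:
  assumes i0: "i0 \<in> J" and i: "i \<in> J" and ne: "i \<noteq> i0" and h: "h \<in> A i0" "h \<noteq> \<one>"
  shows "\<exists>\<sigma>. bij_betw \<sigma> (J - {i0, i}) (S - {\<one>}) \<and>
    (\<forall>j\<in>J - {i0, i}. \<forall>s\<in>S. (\<exists>a\<in>A i. \<exists>b\<in>A j. h = a \<otimes> b \<otimes> s) \<longleftrightarrow> s = \<sigma> j)"
proof -
  have hG: "h \<in> carrier G" using h i0 by auto
  define dec where "dec j s \<longleftrightarrow> (\<exists>a\<in>A i. \<exists>b\<in>A j. h = a \<otimes> b \<otimes> s)" for j s
  have "\<exists>s\<in>S. dec j s" if "j \<in> J - {i0, i}" for j
    unfolding dec_def using decomp[of i j h] i that hG by blast
  then obtain \<sigma> where \<sigma>: "\<And>j. j \<in> J - {i0, i} \<Longrightarrow> \<sigma> j \<in> S" "\<And>j. j \<in> J - {i0, i} \<Longrightarrow> dec j (\<sigma> j)"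
    by metis
  have uniq: "s = \<sigma> j" if j: "j \<in> J - {i0, i}" and s: "s \<in> S" "dec j s" for s j
  proof -
    obtain a b where "a \<in> A i" "b \<in> A j" "h = a \<otimes> b \<otimes> s" using s(2) unfolding dec_def by blast
    moreover obtain a' b' where "a' \<in> A i" "b' \<in> A j" "h = a' \<otimes> b' \<otimes> \<sigma> j"
      using \<sigma>(2)[OF j] unfolding dec_def by blast
    moreover have "i \<in> J" "j \<in> J" "i \<noteq> j" using i j by auto
    ultimately show ?thesis
      using decomp_unique[of i j a a' b b' s "\<sigma> j"] s(1) \<sigma>(1)[OF j] by metis
  qed
  have ne1: "\<sigma> j \<noteq> \<one>" if j: "j \<in> J - {i0, i}" for j
  proof
    assume "\<sigma> j = \<one>"
    then have "dec j \<one>" using \<sigma>(2)[OF j] by simp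
    then obtain a b where ab: "a \<in> A i" "b \<in> A j" "h = a \<otimes> b \<otimes> \<one>"
      unfolding dec_def by blast
    have ij: "i \<in> J" "j \<in> J" "i \<noteq> j" "i \<noteq> i0" "j \<noteq> i0" using i j ne by auto
    have "a \<otimes> b = h" using ab ij by simp
    then show False using K1[OF ij(1,2) i0 ij(3,4,5) ab(1,2) h(1)] h(2) by blast
  qed
  have inj: "inj_on \<sigma> (J - {i0, i})"
  proof (rule inj_onI, rule ccontr)
    fix j k assume jk: "j \<in> J - {i0, i}" "k \<in> J - {i0, i}" "\<sigma> j = \<sigma> k" "j \<noteq> k"
    have J: "j \<in> J" "k \<in> J" "j \<noteq> i" "k \<noteq> i" using jk by auto
    have s: "\<sigma> k \<in> carrier G" using \<sigma>(1) jk by auto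
    obtain a b where ab: "a \<in> A i" "b \<in> A j" "h = a \<otimes> b \<otimes> \<sigma> k"
      using \<sigma>(2)[OF jk(1)] unfolding dec_def jk(3) by blast
    obtain a' b' where ab': "a' \<in> A i" "b' \<in> A k" "h = a' \<otimes> b' \<otimes> \<sigma> k"
      using \<sigma>(2)[OF jk(2)] unfolding dec_def by blast
    have cc: "a \<in> carrier G" "b \<in> carrier G" "a' \<in> carrier G" "b' \<in> carrier G"
      using ab ab' i J by auto
    have "a \<otimes> b = a' \<otimes> b'" using ab ab' cc s by simp
    then have "inv a' \<otimes> a \<otimes> b = b'" using cc by (simp add: word_simps)
    moreover have "inv a' \<otimes> a \<in> A i" using ab ab' i by simp
    ultimately have "b' = \<one>"
      using K1[of i j k "inv a' \<otimes> a" b b'] i J jk(4) ab(2) ab'(2) by metis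
    then have "h = a' \<otimes> \<sigma> k" using ab' cc by simp
    then have "h = \<one>" using K2[of i0 i h a' "\<sigma> k"] i0 i ne h ab' \<sigma>(1)[OF jk(2)] by metis
    then show False using h by simp
  qed
  have "J - {i0, i} = J - {i0} - {i}" by auto
  then have "card (J - {i0, i}) = q - 1" using card_J finite_J i i0 ne by simp
  moreover have "card (S - {\<one>}) = q - 1" using card_S by (simp add: fin_sub)
  moreover have "\<sigma> ` (J - {i0, i}) \<subseteq> S - {\<one>}" using \<sigma>(1) ne1 by auto
  moreover have "finite (S - {\<one>})" by (simp add: fin_sub)
  ultimately have "\<sigma> ` (J - {i0, i}) = S - {\<one>}"
    using card_image[OF inj] card_subset_eq by metis
  then have "bij_betw \<sigma> (J - {i0, i}) (S - {\<one>})" using inj by (simp add: bij_betw_def)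
  moreover have "\<forall>j\<in>J - {i0, i}. \<forall>s\<in>S. dec j s \<longleftrightarrow> s = \<sigma> j" using uniq \<sigma>(2) by blast
  ultimately show ?thesis unfolding dec_def by blast
qed

text \<open>The \<open>A i\<close> generate \<open>S\<close> because every nontrivial element of \<open>S\<close> is some \<open>inv (a \<otimes> b) \<otimes> h\<close> by
  the surjectivity of the twist.\<close>

lemma A_generate:
  assumes C: "subgroup C G" and AC: "\<And>i. i \<in> J \<Longrightarrow> A i \<subseteq> C"
  shows "C = carrier G"
proof -
  note Cc = subgroup_closed[OF C]
  obtain i0 where i0: "i0 \<in> J" using card_J by (metis Suc_eq_plus1 card.empty equals0I nat.distinct(1))
  obtain i where i: "i \<in> J" "i \<noteq> i0" using ex_other i0 by blast
  have "A i0 \<noteq> {\<one>}" using card_A[OF i0] q_gt by auto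
  then obtain h where h: "h \<in> A i0" "h \<noteq> \<one>" using A_closed(2)[OF i0] by blast
  obtain \<sigma> where \<sigma>: "bij_betw \<sigma> (J - {i0, i}) (S - {\<one>})"
    "\<forall>j\<in>J - {i0, i}. \<forall>s\<in>S. (\<exists>a\<in>A i. \<exists>b\<in>A j. h = a \<otimes> b \<otimes> s) \<longleftrightarrow> s = \<sigma> j"
    using twist_bij[OF i0 i h] by blast
  have SC: "s \<in> C" if s: "s \<in> S" for s
  proof (cases "s = \<one>")
    case False
    then obtain j where j: "j \<in> J - {i0, i}" "s = \<sigma> j"
      using \<sigma>(1) s unfolding bij_betw_def by blast
    then obtain a b where ab: "a \<in> A i" "b \<in> A j" "h = a \<otimes> b \<otimes> s" using \<sigma>(2) s by blast
    have cC: "a \<in> C" "b \<in> C" "h \<in> C" using AC ab i j h i0 by blast+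
    have "s = inv (a \<otimes> b) \<otimes> h" using ab(3) Cc(5)[OF cC(1)] Cc(5)[OF cC(2)] S_closed(5)[OF s]
      by (simp add: inv_cancel_left del: inv_mult_group)
    then show ?thesis using cC Cc(3,4) by simp
  qed (simp add: Cc(2))
  show ?thesis
  proof
    show "carrier G \<subseteq> C"
    proof
      fix g assume "g \<in> carrier G"
      then obtain a b s where "a \<in> A i" "b \<in> A i0" "s \<in> S" "g = a \<otimes> b \<otimes> s"
        using decomp[OF i(1) i0 i(2)] by blast
      then show "g \<in> C" using AC[OF i(1)] AC[OF i0] SC Cc(3) by blast
    qed
  qed (rule Cc(1))
qed

lemma parity:
  assumes D: "subgroup D G" "D \<subseteq> S" "D \<noteq> S"
    and i0: "i0 \<in> J" and h: "h \<in> A i0" "h \<noteq> \<one>"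
    and hc: "\<And>g. g \<in> carrier G \<Longrightarrow> \<exists>d\<in>D. g \<otimes> h = h \<otimes> g \<otimes> d"
    and sc: "\<And>s g. s \<in> S \<Longrightarrow> g \<in> carrier G \<Longrightarrow> \<exists>d\<in>D. s \<otimes> g = g \<otimes> s \<otimes> d"
  shows False
proof -
  note Dc [simp] = subgroup_closed[OF D(1)]
  have hG: "h \<in> carrier G" using h i0 by auto
  \<comment> \<open>A coset \<open>C\<close> of \<open>D\<close> different from \<open>D\<close>
    itself misses \<open>\<one>\<close>, so all of it lies in the range \<open>S - {\<one>}\<close>
    of the twist.\<close>
  obtain c where c: "c \<in> S" "c \<notin> D" using D by auto
  define C where "C = (\<lambda>d. c \<otimes> d) ` D"
  have CS: "C \<subseteq> S" unfolding C_def using c D by auto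
  have "\<one> \<notin> C"
  proof
    assume "\<one> \<in> C"
    then obtain d where "d \<in> D" "\<one> = c \<otimes> d" by (auto simp: C_def)
    then have "inv d = c" using inv_equality[of c d] c(1) Dc(5)[of d] by simp
    then show False using Dc(4)[OF \<open>d \<in> D\<close>] c(2) by simp
  qed
  have cardC: "card C = card D"
    unfolding C_def using c by (intro card_image) (auto simp: inj_on_def)
  \<comment> \<open>Lagrange inside \<open>S\<close> makes \<open>card D\<close> a divisor of
    \<open>q\<close>, hence odd.\<close>
  have "subgroup D (G\<lparr>carrier := S\<rparr>)" using subgroup_incl[OF D(1) S_sub D(2)] .
  then have "card (rcosets\<^bsub>G\<lparr>carrier := S\<rparr>\<^esub> D) * card D = q"
    using group.lagrange[OF subgroup_imp_group[OF S_sub]] card_S by (simp add: order_def)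
  then have oddD: "odd (card D)" using q_odd by auto
  define J0 where "J0 = J - {i0}"
  have J0: "card J0 = q" "finite J0" unfolding J0_def using card_J i0 finite_J by auto
  have J0J: "j \<in> J0 \<Longrightarrow> j \<in> J \<and> j \<noteq> i0" for j unfolding J0_def by auto
  define dec where "dec i j s \<longleftrightarrow> (\<exists>a\<in>A i. \<exists>b\<in>A j. h = a \<otimes> b \<otimes> s)" for i j s
  define E where "E = (SIGMA i:J0. {j \<in> J0 - {i}. \<exists>s\<in>C. dec i j s})"
  \<comment> \<open>Each \<open>i\<close> contributes the preimage of \<open>C\<close> under its
    twist, so \<open>E\<close> has \<open>q * card D\<close> elements.\<close>
  have col: "card {j \<in> J0 - {i}. \<exists>s\<in>C. dec i j s} = card D" if i: "i \<in> J0" for i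
  proof -
    have Ji: "J0 - {i} = J - {i0, i}" unfolding J0_def by auto
    obtain \<sigma> where \<sigma>: "bij_betw \<sigma> (J0 - {i}) (S - {\<one>})"
      "\<forall>j\<in>J0 - {i}. \<forall>s\<in>S. dec i j s \<longleftrightarrow> s = \<sigma> j"
      using twist_bij[OF i0 _ _ h, of i] J0J[OF i] unfolding dec_def Ji by blast
    have inj: "inj_on \<sigma> (J0 - {i})" and im: "\<sigma> ` (J0 - {i}) = S - {\<one>}"
      using \<sigma>(1) by (auto simp: bij_betw_def)
    let ?T = "{j \<in> J0 - {i}. \<exists>s\<in>C. dec i j s}"
    have "(\<exists>s\<in>C. dec i j s) \<longleftrightarrow> \<sigma> j \<in> C" if "j \<in> J0 - {i}" for j
    proof -
      have "dec i j s \<longleftrightarrow> s = \<sigma> j" if "s \<in> C" for s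
        using \<sigma>(2) \<open>j \<in> J0 - {i}\<close> that CS by blast
      moreover have "dec i j (\<sigma> j)" using \<sigma>(2) im \<open>j \<in> J0 - {i}\<close> by blast
      ultimately show ?thesis by blast
    qed
    then have T: "?T = {j \<in> J0 - {i}. \<sigma> j \<in> C}" by blast
    have "\<sigma> ` ?T = C"
    proof
      show "\<sigma> ` ?T \<subseteq> C" using T by auto
      show "C \<subseteq> \<sigma> ` ?T"
      proof
        fix s assume s: "s \<in> C"
        then have "s \<in> S - {\<one>}" using CS \<open>\<one> \<notin> C\<close> by auto
        then obtain j where "j \<in> J0 - {i}" "s = \<sigma> j" using im by (metis imageE)
        then show "s \<in> \<sigma> ` ?T" unfolding T using s by blast
      qed
    qed
    moreover have "inj_on \<sigma> ?T" using inj by (rule inj_on_subset) auto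
    ultimately show ?thesis using card_image[of \<sigma> ?T] cardC by simp
  qed
  have "card E = (\<Sum>i\<in>J0. card {j \<in> J0 - {i}. \<exists>s\<in>C. dec i j s})"
    unfolding E_def using J0(2) by (intro card_SigmaI) auto
  also have "\<dots> = (\<Sum>i\<in>J0. card D)" by (rule sum.cong[OF refl col])
  also have "\<dots> = q * card D" using J0(1) by simp
  finally have "odd (card E)" using oddD q_odd by simp
  moreover have "finite E" unfolding E_def using J0 by auto
  moreover have "irrefl E" by (auto simp: irrefl_def E_def)
  moreover have "sym E"
  proof (rule symI)
    fix i j assume "(i, j) \<in> E"
    then have ij: "i \<in> J0" "j \<in> J0" "i \<noteq> j" and "\<exists>s\<in>C. dec i j s" by (auto simp: E_def)
    then obtain a b s where s: "s \<in> C" and ab: "a \<in> A i" "b \<in> A j" "h = a \<otimes> b \<otimes> s"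
      unfolding dec_def by blast
    have sS: "s \<in> S" using s CS by blast
    have cc: "a \<in> carrier G" "b \<in> carrier G" "s \<in> carrier G"
      using A_closed(5)[of i a] A_closed(5)[of j b] J0J[of i] J0J[of j] ab(1,2) ij sS by simp_all
    \<comment> \<open>Commuting \<open>a\<close> past \<open>h\<close> and past \<open>s\<close>
      costs factors \<open>d\<close> and \<open>e\<close> from \<open>D\<close>. Cancelling
      \<open>a\<close> on the left then exchanges the roles of \<open>i\<close> and
      \<open>j\<close>, and the new factor \<open>s \<otimes> (e \<otimes> d)\<close> stays in
      \<open>C\<close>.\<close>
    obtain d where d: "d \<in> D" "a \<otimes> h = h \<otimes> a \<otimes> d" using hc[OF cc(1)] by blast
    obtain e where e: "e \<in> D" "s \<otimes> a = a \<otimes> s \<otimes> e" using sc[OF sS cc(1)] by blast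
    have de: "d \<in> carrier G" "e \<in> carrier G" using Dc(5) d(1) e(1) by blast+
    have "a \<otimes> h = a \<otimes> b \<otimes> s \<otimes> a \<otimes> d" by (simp only: d(2) ab(3)[symmetric])
    also have "\<dots> = a \<otimes> (b \<otimes> (s \<otimes> a) \<otimes> d)" using cc de by (simp add: m_assoc)
    also have "\<dots> = a \<otimes> (b \<otimes> a \<otimes> (s \<otimes> (e \<otimes> d)))" using cc de by (simp add: m_assoc e(2))
    finally have "h = b \<otimes> a \<otimes> (s \<otimes> (e \<otimes> d))" using cc de hG by simp
    moreover have "s \<otimes> (e \<otimes> d) \<in> C"
    proof -
      obtain f where "f \<in> D" "s = c \<otimes> f" using s unfolding C_def by blast
      moreover have "f \<otimes> (e \<otimes> d) \<in> D" using Dc(3) \<open>f \<in> D\<close> d(1) e(1) by blast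
      moreover have "f \<in> carrier G" "c \<in> carrier G" using Dc(5) \<open>f \<in> D\<close> c(1) by auto
      ultimately show ?thesis unfolding C_def using de by (auto simp: m_assoc)
    qed
    ultimately have "\<exists>s\<in>C. dec j i s" unfolding dec_def using ab by blast
    then show "(j, i) \<in> E" using ij by (auto simp: E_def)
  qed
  ultimately show False using even_card_sym_irrefl by blast
qed

section \<open>Normality of the parts, commutators and the centre\<close>

lemma ex_A_nontrivial:
  assumes "i \<in> J"
  obtains a where "a \<in> A i" "a \<noteq> \<one>" "a \<notin> S"
proof -
  have "A i \<noteq> {\<one>}" using card_A[OF assms] q_gt by auto
  then obtain a where "a \<in> A i" "a \<noteq> \<one>" using A_closed(2)[OF assms] by blast
  then show thesis using that A_Int_S assms by blast
qed

lemma S_nontrivial: "S \<noteq> {\<one>}"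
  using card_S q_gt by auto

lemma ex_J: "\<exists>i. i \<in> J"
  using card_J by (metis Suc_eq_plus1 card.empty equals0I nat.distinct(1))

text \<open>A conjugate of \<open>b\<close> lies in some \<open>B i\<close> by \<open>cover\<close>.
  If \<open>i\<close> differs from \<open>j\<close>, write the conjugating element as
  \<open>a \<otimes> e\<close> with \<open>a\<close> in \<open>A i\<close> and \<open>e\<close> in
  \<open>B j\<close>: undoing the conjugation by \<open>a\<close> shows that
  \<open>e \<otimes> b \<otimes> inv e\<close> is in both parts, so \<open>b\<close> is already in
  the normal subgroup \<open>S\<close>.\<close>

lemma B_normal:
  assumes j: "j \<in> J"
  shows "B j \<lhd> G"
  unfolding normal_inv_iff
proof (intro conjI ballI)
  show "subgroup (B j) G" by (rule B_sub[OF j])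
  fix g b assume g: "g \<in> carrier G" and b: "b \<in> B j"
  have bc: "b \<in> carrier G" using b j by simp
  obtain i where i: "i \<in> J" "g \<otimes> b \<otimes> inv g \<in> B i"
    using cover[of "g \<otimes> b \<otimes> inv g"] g bc by auto
  show "g \<otimes> b \<otimes> inv g \<in> B j"
  proof (cases "i = j")
    case False
    obtain a c s where d: "a \<in> A i" "c \<in> A j" "s \<in> S" "g = a \<otimes> c \<otimes> s"
      using decomp[OF i(1) j False g] by blast
    define e where "e = c \<otimes> s"
    have e: "e \<in> B j" unfolding e_def using d by (auto simp: B_iff)
    have a: "a \<in> B i" using A_le_B d i by auto
    have cc: "a \<in> carrier G" "e \<in> carrier G" using a e i j by auto
    have g_eq: "g = a \<otimes> e" using d i j by (simp add: e_def m_assoc)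
    have "e \<otimes> b \<otimes> inv e = inv a \<otimes> (g \<otimes> b \<otimes> inv g) \<otimes> a"
      unfolding g_eq using cc bc by (simp add: word_simps)
    then have "e \<otimes> b \<otimes> inv e \<in> B i" using a i by simp
    then have "e \<otimes> b \<otimes> inv e \<in> S" using B_Int_B[OF i(1) j False] e b j by simp
    then have "inv e \<otimes> (e \<otimes> b \<otimes> inv e) \<otimes> e \<in> S" using S_conj' cc by blast
    then have "b \<in> S" using cc bc by (simp add: word_simps)
    then show ?thesis using S_conj g S_le_B j by auto
  qed (use i in simp)
qed

lemma B_conj: "\<lbrakk>i \<in> J; g \<in> carrier G; b \<in> B i\<rbrakk> \<Longrightarrow> g \<otimes> b \<otimes> inv g \<in> B i"
  using B_normal normal_inv_iff by blast

text \<open>For elements of different parts, normality puts the commutator into the intersection of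
  these parts. Within one part an auxiliary \<open>c\<close> from another part helps:
  \<open>b \<otimes> c\<close> also lies in another part, so the commutators of \<open>a\<close>
  with \<open>b \<otimes> c\<close> and with \<open>c\<close> are of the first kind.\<close>

lemma commutator_in_S:
  assumes a: "a \<in> carrier G" and b: "b \<in> carrier G"
  shows "a \<otimes> b \<otimes> inv a \<otimes> inv b \<in> S"
proof -
  have diff: "x \<otimes> y \<otimes> inv x \<otimes> inv y \<in> S"
    if ij: "i \<in> J" "j \<in> J" "i \<noteq> j" and x: "x \<in> B i" and y: "y \<in> B j" for i j x y
  proof -
    have c: "x \<in> carrier G" "y \<in> carrier G" using x y ij by auto
    have "x \<otimes> (y \<otimes> inv x \<otimes> inv y) \<in> B i" using B_conj x ij c by simp
    moreover have "x \<otimes> y \<otimes> inv x \<otimes> inv y \<in> B j" using B_conj y ij c by simp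
    ultimately show ?thesis using B_Int_B[OF ij] c by (simp add: m_assoc)
  qed
  obtain i where i: "i \<in> J" "a \<in> B i" using cover a by blast
  obtain j where j: "j \<in> J" "b \<in> B j" using cover b by blast
  show ?thesis
  proof (cases "i = j")
    case True
    obtain k where k: "k \<in> J" "k \<noteq> i" using ex_other i by blast
    obtain c where c: "c \<in> A k" "c \<notin> S" using ex_A_nontrivial k(1) by blast
    have cB: "c \<in> B k" using c k A_le_B by auto
    have cc: "c \<in> carrier G" using c k by simp
    obtain l where l: "l \<in> J" "b \<otimes> c \<in> B l" using cover b cc by blast
    have "l \<noteq> i"
    proof
      assume "l = i"
      then have "inv b \<otimes> (b \<otimes> c) \<in> B i" using l j True by simp
      then have "c \<in> B i" using b cc by (simp add: word_simps)
      then show False using B_Int_B[OF i(1) k(1)] k cB c by auto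
    qed
    then have 1: "a \<otimes> (b \<otimes> c) \<otimes> inv a \<otimes> inv (b \<otimes> c) \<in> S" using diff[of i l] i l by auto
    have 2: "a \<otimes> c \<otimes> inv a \<otimes> inv c \<in> S" using diff[of i k] i k cB by auto
    \<comment> \<open>The identity [a, bc] = [a, b] b [a, c] b^-1, solved for [a, b].\<close>
    have "a \<otimes> b \<otimes> inv a \<otimes> inv b =
      (a \<otimes> (b \<otimes> c) \<otimes> inv a \<otimes> inv (b \<otimes> c)) \<otimes> inv (b \<otimes> (a \<otimes> c \<otimes> inv a \<otimes> inv c) \<otimes> inv b)"
      using a b cc by (simp add: word_simps)
    then show ?thesis using 1 S_conj[OF b 2] by simp
  qed (use diff[OF i(1) j(1) _ i(2) j(2)] in simp)
qed

lemma commutator_in_derived: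
  "\<lbrakk>a \<in> carrier G; b \<in> carrier G\<rbrakk> \<Longrightarrow> a \<otimes> b \<otimes> inv a \<otimes> inv b \<in> derived G (carrier G)"
  unfolding derived_def by (rule generate.incl) auto

lemma derived_subset:
  assumes "subgroup K G" "\<And>a b. \<lbrakk>a \<in> carrier G; b \<in> carrier G\<rbrakk> \<Longrightarrow> a \<otimes> b \<otimes> inv a \<otimes> inv b \<in> K"
  shows "derived G (carrier G) \<subseteq> K"
  unfolding derived_def using assms by (intro generate_subgroup_incl) auto

text \<open>Everything commutes modulo the derived subgroup, so if it were proper in
  \<open>S\<close>, then \<open>parity\<close> would apply with it as \<open>D\<close>.\<close>

lemma derived_eq_S: "derived G (carrier G) = S"
proof (rule ccontr)
  let ?D = "derived G (carrier G)"
  assume ne: "?D \<noteq> S"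
  have sub: "subgroup ?D G" by (simp add: derived_is_subgroup)
  have com: "\<exists>d\<in>?D. g \<otimes> h = h \<otimes> g \<otimes> d" if "g \<in> carrier G" "h \<in> carrier G" for g h
  proof
    show "inv g \<otimes> inv h \<otimes> inv (inv g) \<otimes> inv (inv h) \<in> ?D"
      using that by (intro commutator_in_derived) auto
    show "g \<otimes> h = h \<otimes> g \<otimes> (inv g \<otimes> inv h \<otimes> inv (inv g) \<otimes> inv (inv h))"
      using that by (simp add: word_simps)
  qed
  obtain i where i: "i \<in> J" using ex_J by blast
  obtain h where h: "h \<in> A i" "h \<noteq> \<one>" using ex_A_nontrivial i by blast
  show False
    using parity[OF sub derived_subset[OF S_sub commutator_in_S] ne i h] com h i by auto
qed

text \<open>Stripping the central factor \<open>s\<close> from a central element outside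
  \<open>S\<close> leaves a nontrivial central element of some \<open>A i\<close>, which
  \<open>parity\<close> excludes with trivial \<open>D\<close>.\<close>

lemma center_eq_S:
  assumes c: "S \<subseteq> center G"
  shows "center G = S"
proof (rule ccontr)
  assume "center G \<noteq> S"
  then obtain g where g: "g \<in> center G" "g \<notin> S" using c by auto
  have gc: "g \<in> carrier G" using g by (simp add: center_def)
  obtain i where i: "i \<in> J" "g \<in> B i" using cover gc by blast
  then obtain a s where as: "a \<in> A i" "s \<in> S" "g = a \<otimes> s" by (auto simp: B_iff)
  have sc: "s \<in> carrier G" and ac: "a \<in> carrier G" using as i by auto
  have "a \<noteq> \<one>" using as g by auto
  have "x \<otimes> a = a \<otimes> x" if x: "x \<in> carrier G" for x
  proof -
    have "x \<otimes> a \<otimes> s = a \<otimes> s \<otimes> x" using g x ac sc unfolding as(3) center_def by (simp add: m_assoc)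
    also have "\<dots> = a \<otimes> x \<otimes> s" using c as(2) x ac sc by (auto simp: m_assoc center_def)
    finally show ?thesis using x ac sc by simp
  qed
  then show False
    using parity[OF triv_subgroup _ _ i(1) as(1) \<open>a \<noteq> \<one>\<close>] S_nontrivial ac c
    by (fastforce simp: center_def)
qed

text \<open>Commutators within \<open>A i\<close> also lie in \<open>S\<close>, which meets
  \<open>A i\<close> trivially.\<close>

lemma A_commute: "\<lbrakk>i \<in> J; a \<in> A i; b \<in> A i\<rbrakk> \<Longrightarrow> a \<otimes> b = b \<otimes> a"
proof -
  assume i: "i \<in> J" and ab: "a \<in> A i" "b \<in> A i"
  have c: "a \<in> carrier G" "b \<in> carrier G" using ab i by auto
  have "a \<otimes> b \<otimes> inv a \<otimes> inv b = \<one>"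
    using A_Int_S[OF i] commutator_in_S[OF c] ab i by simp
  then have "a \<otimes> b \<otimes> inv (b \<otimes> a) = \<one>" using c by (simp add: word_simps)
  then show "a \<otimes> b = b \<otimes> a" using c by (metis inv_equality inv_inv inv_closed m_closed)
qed

text \<open>Every element shares some \<open>B i\<close> with all of \<open>S\<close>, which gives
  one direction; conversely \<open>B i\<close> is the product of the abelian \<open>A i\<close> and
  the central \<open>S\<close>.\<close>

lemma B_abelian_iff: "(\<forall>i\<in>J. comm_group (G\<lparr>carrier := B i\<rparr>)) \<longleftrightarrow> S \<subseteq> center G"
proof
  assume ab: "\<forall>i\<in>J. comm_group (G\<lparr>carrier := B i\<rparr>)"
  show "S \<subseteq> center G"
  proof
    fix s assume s: "s \<in> S"
    have "s \<otimes> g = g \<otimes> s" if g: "g \<in> carrier G" for g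
    proof -
      obtain i where i: "i \<in> J" "g \<in> B i" using cover g by blast
      then interpret Bi: comm_group "G\<lparr>carrier := B i\<rparr>" using ab by blast
      show ?thesis using Bi.m_comm[of s g] s i S_le_B by simp
    qed
    then show "s \<in> center G" using s by (simp add: center_def)
  qed
next
  assume c: "S \<subseteq> center G"
  show "\<forall>i\<in>J. comm_group (G\<lparr>carrier := B i\<rparr>)"
  proof
    fix i assume i: "i \<in> J"
    show "comm_group (G\<lparr>carrier := B i\<rparr>)"
    proof (rule group.group_comm_groupI[OF subgroup_imp_group[OF B_sub[OF i]]])
      fix x y assume "x \<in> carrier (G\<lparr>carrier := B i\<rparr>)" "y \<in> carrier (G\<lparr>carrier := B i\<rparr>)"
      then obtain a s b t where d: "a \<in> A i" "s \<in> S" "x = a \<otimes> s" "b \<in> A i" "t \<in> S" "y = b \<otimes> t"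
        by (auto simp: B_iff)
      have cc: "a \<in> carrier G" "s \<in> carrier G" "b \<in> carrier G" "t \<in> carrier G"
        using d i by auto
      have sc: "s \<otimes> g = g \<otimes> s" "t \<otimes> g = g \<otimes> t" if "g \<in> carrier G" for g
        using c d that by (auto simp: center_def)
      have "a \<otimes> s \<otimes> (b \<otimes> t) = a \<otimes> (s \<otimes> b) \<otimes> t" using cc by (simp add: m_assoc)
      also have "\<dots> = a \<otimes> b \<otimes> (t \<otimes> s)" using cc sc(1) by (simp add: m_assoc)
      also have "\<dots> = b \<otimes> a \<otimes> (t \<otimes> s)" using A_commute[OF i d(1) d(4)] by simp
      also have "\<dots> = b \<otimes> (t \<otimes> a) \<otimes> s" using cc sc(2) by (simp add: m_assoc)
      also have "\<dots> = b \<otimes> t \<otimes> (a \<otimes> s)" using cc by (simp add: m_assoc)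
      finally show "x \<otimes>\<^bsub>G\<lparr>carrier := B i\<rparr>\<^esub> y = y \<otimes>\<^bsub>G\<lparr>carrier := B i\<rparr>\<^esub> x" using d by simp
    qed
  qed
qed

section \<open>Powers, exponent and Frattini subgroup\<close>

lemma in_S_iff_coset: "x \<in> carrier G \<Longrightarrow> x \<in> S \<longleftrightarrow> S #> x = S"
  using coset_join1[OF _ _ S_sub] coset_join2[OF _ S_sub] by blast

text \<open>The quotient by \<open>S\<close> is abelian by \<open>commutator_in_S\<close>, so powers
  distribute there; \<open>z\<close> is the error term of lifting back to \<open>G\<close>.\<close>

lemma mult_pow_mod_S:
  assumes x: "x \<in> carrier G" and y: "y \<in> carrier G"
  shows "\<exists>z\<in>S. (x \<otimes> y) [^] (k::nat) = z \<otimes> (x [^] k \<otimes> y [^] k)"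
proof -
  interpret N: normal S G by (rule S_normal)
  interpret Q: group "G Mod S" by (rule N.factorgroup_is_group)
  have hom: "(\<lambda>a. S #> a) \<in> hom G (G Mod S)" by (rule N.r_coset_hom_Mod)
  have m: "S #> (u \<otimes> v) = (S #> u) \<otimes>\<^bsub>G Mod S\<^esub> (S #> v)"
    if "u \<in> carrier G" "v \<in> carrier G" for u v
    using hom that by (rule hom_mult)
  have pow: "S #> (u [^] n) = (S #> u) [^]\<^bsub>G Mod S\<^esub> n" if "u \<in> carrier G" for u and n :: nat
    using hom_nat_pow[OF hom that is_group Q.is_group] .
  have cl: "S #> u \<in> carrier (G Mod S)" if "u \<in> carrier G" for u
    using hom that by (rule hom_in_carrier)
  have "S #> (x \<otimes> y) = S #> ((x \<otimes> y \<otimes> inv x \<otimes> inv y) \<otimes> (y \<otimes> x))"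
    using x y by (simp add: word_simps)
  also have "\<dots> = S #> (x \<otimes> y \<otimes> inv x \<otimes> inv y) #> (y \<otimes> x)"
    using x y S_closed(1) by (intro coset_mult_assoc[symmetric]) simp_all
  also have "S #> (x \<otimes> y \<otimes> inv x \<otimes> inv y) = S"
    using commutator_in_S[OF x y] in_S_iff_coset S_closed(5) by blast
  finally have com: "(S #> x) \<otimes>\<^bsub>G Mod S\<^esub> (S #> y) = (S #> y) \<otimes>\<^bsub>G Mod S\<^esub> (S #> x)"
    by (simp only: m[OF x y] m[OF y x])
  have "S #> ((x \<otimes> y) [^] k) = (S #> (x \<otimes> y)) [^]\<^bsub>G Mod S\<^esub> k"
    using x y by (intro pow) simp
  also have "\<dots> = (S #> x) [^]\<^bsub>G Mod S\<^esub> k \<otimes>\<^bsub>G Mod S\<^esub> (S #> y) [^]\<^bsub>G Mod S\<^esub> k"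
    by (simp only: m[OF x y] Q.pow_mult_distrib[OF com cl[OF x] cl[OF y]])
  also have "\<dots> = S #> (x [^] k \<otimes> y [^] k)"
    by (simp only: m[OF nat_pow_closed[OF x] nat_pow_closed[OF y]] pow[OF x] pow[OF y])
  finally have "S #> ((x \<otimes> y) [^] k) = S #> (x [^] k \<otimes> y [^] k)" .
  then have "(x \<otimes> y) [^] k \<in> S #> (x [^] k \<otimes> y [^] k)"
    using rcos_self[OF _ S_sub, of "(x \<otimes> y) [^] k"] x y by simp
  then show ?thesis by (auto simp: r_coset_def)
qed

text \<open>An abelian \<open>p\<close>-group with a nontrivial partition is elementary abelian;
  here the group is the quotient by \<open>S\<close>. One element \<open>v\<close> outside
  \<open>S\<close> with \<open>p\<close>-th power in \<open>S\<close> is found first, and the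
  partition spreads the property to all elements.\<close>

lemma pow_in_S:
  assumes p: "Factorial_Ring.prime (p::nat)" and qp: "q = p ^ n" and g: "g \<in> carrier G"
  shows "g [^] p \<in> S"
proof -
  obtain i0 where i0: "i0 \<in> J" using ex_J by blast
  obtain w where w: "w \<in> A i0" "w \<notin> S" using ex_A_nontrivial i0 by blast
  have wc: "w \<in> carrier G" using w i0 by simp
  \<comment> \<open>The order of \<open>G\<close> is \<open>p ^ (n * 3)\<close>, so repeated
    \<open>p\<close>-th powers of \<open>w\<close> end in \<open>S\<close>; \<open>v\<close> is the
    last one outside \<open>S\<close>.\<close>
  have "w [^] (p ^ (n * 3)) = \<one>"
    using pow_order_eq_1[OF wc] order_G qp by (simp add: order_def power_mult)
  then have ex: "\<exists>m. w [^] (p ^ m) \<in> S" by (metis S_closed(2))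
  define m where "m = (LEAST m. w [^] (p ^ m) \<in> S)"
  have m: "w [^] (p ^ m) \<in> S" unfolding m_def using ex by (rule LeastI_ex)
  have "m \<noteq> 0" using m w wc by (auto intro: ccontr)
  then obtain k where k: "m = Suc k" using not0_implies_Suc by blast
  define v where "v = w [^] (p ^ k)"
  have v: "v \<in> carrier G" "v \<notin> S" "v [^] p \<in> S"
    using wc m not_less_Least[of k "\<lambda>m. w [^] (p ^ m) \<in> S"] k
    by (auto simp: v_def m_def[symmetric] nat_pow_pow mult.commute)
  obtain i where i: "i \<in> J" "v \<in> B i" using cover v by blast
  \<comment> \<open>If \<open>x\<close> and \<open>y\<close> lie in different parts, then \<open>x \<otimes> y\<close> lies in yet another one, which contains
    \<open>y [^] p\<close> modulo \<open>S\<close>.\<close>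
  have off: "y [^] p \<in> S"
    if ij: "i \<in> J" "j \<in> J" "i \<noteq> j" and x: "x \<in> B i" "x \<notin> S" "x [^] p \<in> S" and y: "y \<in> B j"
    for i j x y
  proof (cases "y \<in> S")
    case False
    have c: "x \<in> carrier G" "y \<in> carrier G" using x y ij by auto
    obtain l where l: "l \<in> J" "x \<otimes> y \<in> B l" using cover c by blast
    have "l \<noteq> j"
    proof
      assume "l = j"
      then have "x \<otimes> y \<otimes> inv y \<in> B j" using l y by simp
      then have "x \<in> B j" using c by (simp add: word_simps)
      then show False using B_Int_B[OF ij x(1)] x by auto
    qed
    have mem: "(x \<otimes> y) [^] p \<in> B l" using subgroup_nat_pow_closed[OF B_sub] l by blast
    have xl: "x [^] p \<in> B l" using S_le_B l x by blast
    obtain z where z: "z \<in> S" "(x \<otimes> y) [^] p = z \<otimes> (x [^] p \<otimes> y [^] p)"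
      using mult_pow_mod_S[OF c] by blast
    have "y [^] p = inv (x [^] p) \<otimes> (inv z \<otimes> (x \<otimes> y) [^] p)"
      using z c by (simp add: word_simps)
    moreover have "inv z \<otimes> (x \<otimes> y) [^] p \<in> B l"
      using mem z S_le_B l by (meson B_closed(3,4) S_closed(4))
    ultimately have "y [^] p \<in> B l" using xl l by simp
    moreover have "y [^] p \<in> B j" using subgroup_nat_pow_closed[OF B_sub] ij y by blast
    ultimately show ?thesis using B_Int_B l ij \<open>l \<noteq> j\<close> by blast
  qed (use subgroup_nat_pow_closed[OF S_sub] in blast)
  obtain j where j: "j \<in> J" "g \<in> B j" using cover g by blast
  show ?thesis
  proof (cases "i = j")
    case True
    \<comment> \<open>\<open>off\<close> compares different parts only, so within the part of
      \<open>v\<close> it is applied twice, through an element \<open>c\<close> of another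
      part.\<close>
    obtain k where k: "k \<in> J" "k \<noteq> i" using ex_other i by blast
    obtain c where c: "c \<in> A k" "c \<notin> S" using ex_A_nontrivial k(1) by blast
    have cB: "c \<in> B k" using c k A_le_B by auto
    then have "c [^] p \<in> S" using off[of i k v c] i k v by auto
    then show ?thesis using off[of k i c g] i j k True cB c by auto
  qed (use off[of i j v g] i j v in auto)
qed

text \<open>The elements of \<open>S\<close> with trivial \<open>p\<close>-th power form a subgroup
  because \<open>S\<close> is commutative. It contains each commutator \<open>d\<close> of
  \<open>a\<close> and \<open>b\<close>: as \<open>d\<close> is central, \<open>d [^] p\<close> is
  the commutator of \<open>a [^] p\<close> and \<open>b\<close>, and \<open>a [^] p\<close> lies in
  the central \<open>S\<close> by \<open>pow_in_S\<close>. Commutators generate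
  \<open>S\<close>.\<close>

lemma central_S_pow:
  assumes p: "Factorial_Ring.prime (p::nat)" and qp: "q = p ^ n" and c: "S \<subseteq> center G" and s: "s \<in> S"
  shows "s [^] p = \<one>"
proof -
  have cen: "s \<otimes> g = g \<otimes> s" if "s \<in> S" "g \<in> carrier G" for s g
    using c that by (auto simp: center_def)
  define T where "T = {s \<in> S. s [^] p = \<one>}"
  have "subgroup T G"
  proof (rule subgroupI)
    show "T \<subseteq> carrier G" unfolding T_def using S_closed(5) by blast
    have "\<one> \<in> T" unfolding T_def by simp
    then show "T \<noteq> {}" by blast
    fix a assume a: "a \<in> T"
    then show "inv a \<in> T" unfolding T_def by (simp add: nat_pow_inv)
    fix b assume b: "b \<in> T"
    have "(a \<otimes> b) [^] p = a [^] p \<otimes> b [^] p"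
      using a b cen by (intro pow_mult_distrib) (auto simp: T_def)
    then show "a \<otimes> b \<in> T" using a b unfolding T_def by simp
  qed
  moreover have "a \<otimes> b \<otimes> inv a \<otimes> inv b \<in> T" if a: "a \<in> carrier G" and b: "b \<in> carrier G" for a b
  proof -
    define d where "d = a \<otimes> b \<otimes> inv a \<otimes> inv b"
    have d: "d \<in> S" unfolding d_def using a b by (rule commutator_in_S)
    have dc: "d \<in> carrier G" using d by simp
    have ab: "a \<otimes> b = d \<otimes> (b \<otimes> a)" unfolding d_def using a b by (simp add: word_simps)
    have "a [^] k \<otimes> b = d [^] k \<otimes> (b \<otimes> a [^] k)" for k :: nat
    proof (induction k)
      case (Suc k)
      have "a [^] Suc k \<otimes> b = a [^] k \<otimes> (a \<otimes> b)" using a b by (simp add: m_assoc)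
      also have "\<dots> = (a [^] k \<otimes> d) \<otimes> (b \<otimes> a)" using a b dc by (simp only: ab) (simp add: m_assoc)
      also have "\<dots> = (d \<otimes> a [^] k) \<otimes> (b \<otimes> a)" using cen[OF d, of "a [^] k"] a by simp
      also have "\<dots> = d \<otimes> (a [^] k \<otimes> b) \<otimes> a" using a b dc by (simp add: m_assoc)
      also have "\<dots> = d \<otimes> (d [^] k \<otimes> (b \<otimes> a [^] k)) \<otimes> a" by (simp only: Suc.IH)
      also have "\<dots> = (d \<otimes> d [^] k) \<otimes> (b \<otimes> (a [^] k \<otimes> a))" using a b dc by (simp add: m_assoc)
      also have "\<dots> = d [^] Suc k \<otimes> (b \<otimes> a [^] Suc k)" using nat_pow_Suc2[OF dc, of k] by simp
      finally show ?case .
    qed (use b in simp)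
    from this[of p] have "a [^] p \<otimes> b = d [^] p \<otimes> (a [^] p \<otimes> b)"
      using cen[OF pow_in_S[OF p qp a] b] by simp
    then have "d [^] p = \<one>" using a b dc by (metis m_closed nat_pow_closed r_cancel_one')
    then show ?thesis using d by (simp add: T_def d_def[symmetric])
  qed
  ultimately have "derived G (carrier G) \<subseteq> T" by (rule derived_subset)
  then show ?thesis using s by (auto simp: derived_eq_S T_def)
qed

text \<open>Write \<open>g\<close> as \<open>a \<otimes> s\<close>. The \<open>p\<close>-th power of
  \<open>a\<close> lies in \<open>A i\<close> and in \<open>S\<close>, hence is trivial, and
  \<open>central_S_pow\<close> deals with \<open>s\<close>.\<close>

lemma central_S_exponent:
  assumes p: "Factorial_Ring.prime (p::nat)" and qp: "q = p ^ n" and c: "S \<subseteq> center G"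
    and g: "g \<in> carrier G"
  shows "g [^] p = \<one>"
proof -
  obtain i where i: "i \<in> J" "g \<in> B i" using cover g by blast
  then obtain a s where as: "a \<in> A i" "s \<in> S" "g = a \<otimes> s" by (auto simp: B_iff)
  have ac: "a \<in> carrier G" and sc: "s \<in> carrier G" using as i by auto
  have "a [^] p = \<one>"
    using A_Int_S[OF i(1)] subgroup_nat_pow_closed[OF A_sub as(1)] pow_in_S[OF p qp ac] i by blast
  moreover have "a \<otimes> s = s \<otimes> a" using c as(2) ac by (auto simp: center_def)
  ultimately show ?thesis
    unfolding as(3) using pow_mult_distrib[of a s] ac sc central_S_pow[OF p qp c as(2)] by simp
qed

lemma central_S_group_exponent:
  assumes p: "Factorial_Ring.prime (p::nat)" and qp: "q = p ^ n" and c: "S \<subseteq> center G"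
  shows "group_exponent G = p"
  unfolding group_exponent_def
proof (rule Least_equality)
  show "0 < p \<and> (\<forall>g\<in>carrier G. g [^] p = \<one>)"
    using p prime_gt_0_nat central_S_exponent[OF p qp c] by blast
  fix m :: nat assume m: "0 < m \<and> (\<forall>g\<in>carrier G. g [^] m = \<one>)"
  obtain g where g: "g \<in> S" "g \<noteq> \<one>" using S_nontrivial S_closed(2) by blast
  have gc: "g \<in> carrier G" using g by simp
  have "ord g dvd p" using central_S_exponent[OF p qp c gc] pow_eq_id[OF gc] by simp
  moreover have "ord g \<noteq> 1" using g gc by (metis ord_eq_1)
  ultimately have "ord g = p" using p prime_nat_iff by blast
  moreover have "g [^] m = \<one>" using m gc by blast
  ultimately have "p dvd m" using pow_eq_id[OF gc] by blast
  then show "p \<le> m" using m dvd_imp_le by blast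
qed

text \<open>If a maximal \<open>M\<close> did not contain \<open>S\<close>, then
  \<open>M <#> S\<close> would be all of \<open>G\<close>; as \<open>S\<close> is central, all
  commutators would be commutators of elements of \<open>M\<close>, although they generate
  \<open>S\<close>. Conversely, the quotient by \<open>S\<close> is elementary abelian, so each
  element outside \<open>S\<close> is avoided by a maximal subgroup.\<close>

lemma central_S_frattini:
  assumes p: "Factorial_Ring.prime (p::nat)" and qp: "q = p ^ n" and c: "S \<subseteq> center G"
  shows "frattini G = S"
proof
  have cen: "s \<otimes> g = g \<otimes> s" if "s \<in> S" "g \<in> carrier G" for s g
    using c that by (auto simp: center_def)
  show "S \<subseteq> frattini G"
  proof -
    have "S \<subseteq> M" if max: "maximal_subgroup G M" for M
    proof (rule ccontr)
      assume no: "\<not> S \<subseteq> M"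
      have M: "subgroup M G" "M \<noteq> carrier G" using max by (auto simp: maximal_subgroup_def)
      note Mc = subgroup_closed[OF M(1)]
      have "subgroup (M <#> S) G"
        using mult_norm_subgroup[OF S_normal M(1)]
        by (simp add: commut_normal[OF M(1) S_normal, symmetric])
      moreover have "M \<subseteq> M <#> S"
      proof
        fix m assume "m \<in> M"
        then have "m \<otimes> \<one> \<in> M <#> S" unfolding set_mult_def using S_closed(2) by blast
        then show "m \<in> M <#> S" using Mc(5) \<open>m \<in> M\<close> by simp
      qed
      moreover have "S \<subseteq> M <#> S"
      proof
        fix s assume "s \<in> S"
        then have "\<one> \<otimes> s \<in> M <#> S" unfolding set_mult_def using Mc(2) by blast
        then show "s \<in> M <#> S" using S_closed(5) \<open>s \<in> S\<close> by simp
      qed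
      ultimately have MS: "M <#> S = carrier G"
        using max no unfolding maximal_subgroup_def by blast
      have "a \<otimes> b \<otimes> inv a \<otimes> inv b \<in> M" if a: "a \<in> carrier G" and b: "b \<in> carrier G" for a b
      proof -
        obtain m s where ms: "m \<in> M" "s \<in> S" "a = m \<otimes> s" using a unfolding MS[symmetric] set_mult_def by blast
        obtain k t where kt: "k \<in> M" "t \<in> S" "b = k \<otimes> t" using b unfolding MS[symmetric] set_mult_def by blast
        have cc: "m \<in> carrier G" "s \<in> carrier G" "k \<in> carrier G" "t \<in> carrier G"
          using ms kt Mc(5) S_closed(5) by blast+
        have "a \<otimes> b \<otimes> inv a \<otimes> inv b
          = m \<otimes> ((s \<otimes> k) \<otimes> (t \<otimes> inv s)) \<otimes> inv m \<otimes> inv t \<otimes> inv k"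
          unfolding ms(3) kt(3) using cc by (simp add: word_simps)
        also have "\<dots> = m \<otimes> ((k \<otimes> s) \<otimes> (inv s \<otimes> t)) \<otimes> inv m \<otimes> inv t \<otimes> inv k"
          using cen[OF ms(2) cc(3)] cen[OF kt(2), of "inv s"] cc by simp
        also have "\<dots> = m \<otimes> k \<otimes> (t \<otimes> inv m) \<otimes> inv t \<otimes> inv k"
          using cc by (simp add: word_simps)
        also have "\<dots> = m \<otimes> k \<otimes> inv m \<otimes> inv k"
          using cen[OF kt(2), of "inv m"] cc by (simp add: word_simps)
        finally show ?thesis using Mc ms(1) kt(1) by simp
      qed
      then show False using derived_subset[OF M(1)] derived_eq_S no by blast
    qed
    then show ?thesis unfolding frattini_def using S_closed(1) by blast
  qed
  show "frattini G \<subseteq> S"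
  proof (rule ccontr)
    assume "\<not> frattini G \<subseteq> S"
    then obtain g where g: "g \<in> frattini G" "g \<notin> S" by blast
    have gc: "g \<in> carrier G" using g by (simp add: frattini_def)
    \<comment> \<open>A largest subgroup that contains \<open>S\<close> and avoids \<open>g\<close>
      turns out to be maximal in \<open>G\<close>.\<close>
    define \<K> where "\<K> = {K. subgroup K G \<and> S \<subseteq> K \<and> g \<notin> K}"
    have "finite \<K>"
      by (rule finite_subset[of _ "Pow (carrier G)"]) (auto simp: \<K>_def fin dest: subgroup.subset)
    moreover have "S \<in> \<K>" using g by (simp add: \<K>_def S_sub)
    ultimately obtain K where K: "K \<in> \<K>" "\<And>K'. K' \<in> \<K> \<Longrightarrow> K \<subseteq> K' \<Longrightarrow> K' = K"
      using finite_has_maximal[of \<K>] by blast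
    have Ks: "subgroup K G" "S \<subseteq> K" "g \<notin> K" using K(1) by (auto simp: \<K>_def)
    note Kc = subgroup_closed[OF Ks(1)]
    have gK: "g \<in> M" if "subgroup M G" "K \<subset> M" for M
      using K(2)[of M] that Ks unfolding \<K>_def by blast
    \<comment> \<open>Both \<open>M\<close> and \<open>K <#> generate G {x}\<close> contain
      \<open>g\<close> by the choice of \<open>K\<close>. So some power \<open>y\<close> of
      \<open>x\<close> differs from \<open>g\<close> by a factor in \<open>K\<close> and lies in
      \<open>M\<close>; its exponent is coprime to \<open>p\<close>, which recovers \<open>x\<close>
      from \<open>y\<close>.\<close>
    have gen: "x \<in> M" if M: "subgroup M G" "K \<subset> M" and x: "x \<in> carrier G" for x M
    proof (cases "x \<in> K")
      case False
      \<comment> \<open>\<open>K\<close> contains \<open>S\<close> and with it all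
        commutators.\<close>
      have "K \<lhd> G"
        unfolding normal_inv_iff
      proof (intro conjI ballI)
        fix a k assume ak: "a \<in> carrier G" "k \<in> K"
        then have "a \<otimes> k \<otimes> inv a \<otimes> inv k \<otimes> k \<in> K"
          using Kc(3)[of "a \<otimes> k \<otimes> inv a \<otimes> inv k" k] commutator_in_S[of a k] Ks(2) Kc(5) by blast
        then show "a \<otimes> k \<otimes> inv a \<in> K" using ak Kc(5) by (simp add: word_simps)
      qed (rule Ks(1))
      note Kn = this
      have xs: "subgroup (generate G {x}) G" using x by (simp add: generate_is_subgroup)
      have "subgroup (K <#> generate G {x}) G" using mult_norm_subgroup[OF Kn xs] .
      moreover have "k \<in> K <#> generate G {x}" if "k \<in> K" for k
      proof -
        have "k \<otimes> \<one> \<in> K <#> generate G {x}"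
          unfolding set_mult_def using that subgroup_closed(2)[OF xs] by blast
        then show ?thesis using that Kc(5) by simp
      qed
      moreover have "x \<in> K <#> generate G {x}"
      proof -
        have "\<one> \<otimes> x \<in> K <#> generate G {x}"
          unfolding set_mult_def using Kc(2) generate.incl[of x "{x}" G] by blast
        then show ?thesis using x by simp
      qed
      ultimately have "g \<in> K <#> generate G {x}" using gK[of "K <#> generate G {x}"] False by blast
      then obtain k y where ky: "k \<in> K" "y \<in> generate G {x}" "g = k \<otimes> y"
        by (auto simp: set_mult_def)
      obtain e :: int where e: "y = x [^] e" using ky(2) generate_pow[OF x] by auto
      have kc: "k \<in> carrier G" using ky Kc(5) by blast
      have xp: "x [^] int p = \<one>"
        using central_S_exponent[OF p qp c x] by (simp add: int_pow_int)
      have "coprime (int p) e"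
      proof (rule ccontr)
        assume "\<not> coprime (int p) e"
        then have "int p dvd e" using p prime_imp_coprime[of "int p" e] by auto
        then obtain f where "e = int p * f" by auto
        then have "y = \<one>" using e x xp int_pow_pow[OF x, of "int p" f] by simp
        then show False using ky kc Ks(3) by simp
      qed
      then obtain u v where uv: "u * int p + v * e = 1" by (metis coprime_iff_gcd_eq_1 bezout_int)
      have "y = inv k \<otimes> g" using ky(3) kc e x by (simp add: word_simps)
      then have yM: "y \<in> M" using ky(1) gK[OF M] M subgroup_closed(3,4)[OF M(1)] by blast
      have "x = x [^] (int p * u + e * v)" using uv x by (simp add: mult.commute int_pow_1)
      also have "\<dots> = x [^] (int p * u) \<otimes> x [^] (e * v)" using int_pow_mult[OF x] .
      also have "\<dots> = y [^] v" using x xp e by (simp add: int_pow_pow[symmetric])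
      finally show ?thesis using yM int_pow_closed subgroup_int_pow_closed[OF M(1)] by metis
    qed (use that in blast)
    have "maximal_subgroup G K"
      unfolding maximal_subgroup_def
    proof (intro conjI allI impI)
      fix M assume M: "subgroup M G" "K \<subseteq> M"
      show "M = K \<or> M = carrier G"
      proof (cases "M = K")
        case False
        then have "K \<subset> M" using M by blast
        then show ?thesis using gen[OF M(1)] subgroup.subset[OF M(1)] by blast
      qed simp
    qed (use Ks gc in auto)
    then show False using g Ks by (simp add: frattini_def)
  qed
qed

lemma central_S_special:
  assumes p: "Factorial_Ring.prime (p::nat)" and qp: "q = p ^ n" and c: "S \<subseteq> center G"
  shows "special_group p G"
proof -
  have "comm_group (G\<lparr>carrier := S\<rparr>)"
  proof (rule group.group_comm_groupI[OF subgroup_imp_group[OF S_sub]])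
    fix x y assume "x \<in> carrier (G\<lparr>carrier := S\<rparr>)" "y \<in> carrier (G\<lparr>carrier := S\<rparr>)"
    then have "x \<in> center G" "y \<in> carrier G" using c S_closed(5) by auto
    then show "x \<otimes>\<^bsub>G\<lparr>carrier := S\<rparr>\<^esub> y = y \<otimes>\<^bsub>G\<lparr>carrier := S\<rparr>\<^esub> x" by (simp add: center_def)
  qed
  then have "elementary_abelian p G S"
    unfolding elementary_abelian_def using central_S_pow[OF p qp c] by blast
  moreover have "p_group p G"
    unfolding p_group_def using fin order_G qp by (metis is_group power_mult)
  ultimately show ?thesis
    unfolding special_group_def using center_eq_S[OF c] derived_eq_S central_S_frattini[OF p qp c]
    by simp
qed

text \<open>In a special group the centre is the derived subgroup, which is \<open>S\<close> by
  \<open>derived_eq_S\<close>; the other direction collects the preceding lemmas.\<close>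

theorem special_iff_central:
  assumes "Factorial_Ring.prime (p::nat)" "q = p ^ n"
  shows "special_group p G \<and> group_exponent G = p \<longleftrightarrow> S \<subseteq> center G"
  using assms central_S_special central_S_group_exponent derived_eq_S
  by (auto simp: special_group_def)

end

section \<open>Generalized quadrangles\<close>

locale generalized_quadrangle =
  fixes P :: "'p set" and L :: "'l set" and I :: "'p \<Rightarrow> 'l \<Rightarrow> bool" and s t :: nat
  assumes GQ: "is_GQ P L I s t"
begin

abbreviation col :: "'p \<Rightarrow> 'p \<Rightarrow> bool" where "col \<equiv> collinear P L I"

abbreviation pr :: "'l \<Rightarrow> 'p \<Rightarrow> 'p" where "pr \<equiv> proj P L I"

lemma finite_P: "finite P" and finite_L: "finite L"
  and card_points: "l \<in> L \<Longrightarrow> card {a\<in>P. I a l} = s + 1"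
  and card_lines: "a \<in> P \<Longrightarrow> card {l\<in>L. I a l} = t + 1"
  and card_join: "\<lbrakk>a \<in> P; b \<in> P; a \<noteq> b\<rbrakk> \<Longrightarrow> card {l\<in>L. I a l \<and> I b l} \<le> 1"
  and proj_ex1: "\<lbrakk>a \<in> P; l \<in> L; \<not> I a l\<rbrakk> \<Longrightarrow> \<exists>!b. b \<in> P \<and> I b l \<and> col a b"
  using GQ unfolding is_GQ_def by blast+

lemma join_unique:
  assumes "a \<in> P" "b \<in> P" "a \<noteq> b" "l \<in> L" "m \<in> L" "I a l" "I b l" "I a m" "I b m"
  shows "l = m"
proof -
  have "card {l\<in>L. I a l \<and> I b l} \<le> Suc 0" using card_join[OF assms(1-3)] by simp
  moreover have "finite {l\<in>L. I a l \<and> I b l}" using finite_L by simp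
  ultimately show ?thesis using assms(4-9) by (auto simp: card_le_Suc0_iff_eq)
qed

lemma colI: "\<lbrakk>a \<in> P; b \<in> P; m \<in> L; I a m; I b m\<rbrakk> \<Longrightarrow> col a b"
  unfolding collinear_def by blast

lemma col_sym: "col a b \<Longrightarrow> col b a"
  unfolding collinear_def by blast

lemma colE:
  assumes "col a b"
  obtains m where "a \<in> P" "b \<in> P" "m \<in> L" "I a m" "I b m"
  using assms unfolding collinear_def by blast

lemma proj_props:
  assumes "a \<in> P" "l \<in> L" "\<not> I a l"
  shows "pr l a \<in> P" "I (pr l a) l" "col a (pr l a)"
  using theI'[OF proj_ex1[OF assms]] unfolding proj_def by auto

lemma proj_unique:
  assumes "a \<in> P" "l \<in> L" "\<not> I a l" "b \<in> P" "I b l" "col a b"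
  shows "b = pr l a"
  using proj_ex1[OF assms(1-3)] proj_props[OF assms(1-3)] assms(4-6) by blast

lemma no_triangle:
  assumes "a \<in> P" "l \<in> L" "\<not> I a l" "b \<in> P" "I b l" "col a b" "c \<in> P" "I c l" "col a c"
  shows "b = c"
  using proj_unique[OF assms(1-3)] assms(4-9) by metis

section \<open>Automorphisms of a generalized quadrangle\<close>

lemma autD:
  assumes "h \<in> Aut P L I"
  shows "bij_betw (fst h) P P" "\<forall>a. a \<notin> P \<longrightarrow> fst h a = a"
    "bij_betw (snd h) L L" "\<forall>l. l \<notin> L \<longrightarrow> snd h l = l"
    "\<forall>a\<in>P. \<forall>l\<in>L. I a l \<longleftrightarrow> I (fst h a) (snd h l)"
  using assms by (auto simp: Aut_def)

lemma aut_point: "\<lbrakk>h \<in> Aut P L I; a \<in> P\<rbrakk> \<Longrightarrow> fst h a \<in> P"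
  using autD(1) bij_betwE by blast

lemma aut_line: "\<lbrakk>h \<in> Aut P L I; l \<in> L\<rbrakk> \<Longrightarrow> snd h l \<in> L"
  using autD(3) bij_betwE by blast

lemma aut_inj_point: "\<lbrakk>h \<in> Aut P L I; a \<in> P; b \<in> P; fst h a = fst h b\<rbrakk> \<Longrightarrow> a = b"
  using inj_onD[OF bij_betw_imp_inj_on[OF autD(1)]] by blast

lemma aut_inj_line: "\<lbrakk>h \<in> Aut P L I; l \<in> L; m \<in> L; snd h l = snd h m\<rbrakk> \<Longrightarrow> l = m"
  using inj_onD[OF bij_betw_imp_inj_on[OF autD(3)]] by blast

lemma aut_surj_line: "\<lbrakk>h \<in> Aut P L I; l \<in> L\<rbrakk> \<Longrightarrow> \<exists>m\<in>L. snd h m = l"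
  using bij_betw_imp_surj_on[OF autD(3), of h] by (metis imageE)

lemma aut_inc: "\<lbrakk>h \<in> Aut P L I; a \<in> P; l \<in> L\<rbrakk> \<Longrightarrow> I (fst h a) (snd h l) \<longleftrightarrow> I a l"
  using autD(5) by blast

lemma aut_col:
  assumes h: "h \<in> Aut P L I" and a: "a \<in> P" and b: "b \<in> P"
  shows "col (fst h a) (fst h b) \<longleftrightarrow> col a b"
proof
  assume "col a b"
  then obtain m where "m \<in> L" "I a m" "I b m" by (rule colE)
  then show "col (fst h a) (fst h b)"
    using colI[of _ _ "snd h m"] aut_point[OF h] aut_line[OF h] aut_inc[OF h] a b by simp
next
  assume "col (fst h a) (fst h b)"
  then obtain l where l: "l \<in> L" "I (fst h a) l" "I (fst h b) l" by (rule colE)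
  then obtain m where "m \<in> L" "snd h m = l" using aut_surj_line[OF h] by blast
  then show "col a b" using l colI[OF a b, of m] aut_inc[OF h a, of m] aut_inc[OF h b, of m] by simp
qed

lemma AutGroup_simps [simp]:
  "carrier (AutGroup P L I) = Aut P L I"
  "g \<otimes>\<^bsub>AutGroup P L I\<^esub> h = (fst g \<circ> fst h, snd g \<circ> snd h)"
  "\<one>\<^bsub>AutGroup P L I\<^esub> = (id, id)"
  by (simp_all add: AutGroup_def)

lemma aut_comp:
  assumes g: "g \<in> Aut P L I" and h: "h \<in> Aut P L I"
  shows "(fst g \<circ> fst h, snd g \<circ> snd h) \<in> Aut P L I"
proof -
  have "bij_betw (fst g \<circ> fst h) P P" "bij_betw (snd g \<circ> snd h) L L"
    using bij_betw_trans autD(1,3) g h by blast+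
  moreover have "I a l \<longleftrightarrow> I (fst g (fst h a)) (snd g (snd h l))" if "a \<in> P" "l \<in> L" for a l
    using aut_inc[OF g] aut_inc[OF h] aut_point[OF h] aut_line[OF h] that by simp
  ultimately show ?thesis
    using autD(2,4)[OF g] autD(2,4)[OF h] unfolding Aut_def by simp
qed

text \<open>Being the identity outside \<open>P\<close> and \<open>L\<close>, the components of an
  automorphism are permutations of the whole types and have inverse functions there.\<close>

lemma bij_betw_inverse:
  assumes "bij_betw f D D" "\<forall>a. a \<notin> D \<longrightarrow> f a = a"
  shows "\<exists>g. bij_betw g D D \<and> (\<forall>a. a \<notin> D \<longrightarrow> g a = a) \<and> g \<circ> f = id \<and> f \<circ> g = id"
proof -
  have p: "f permutes D" using assms by (simp add: bij_imp_permutes)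
  show ?thesis
    using permutes_imp_bij[OF permutes_inv[OF p]] permutes_not_in[OF permutes_inv[OF p]]
      permutes_inv_o[OF p] by blast
qed

lemma aut_inverse:
  assumes h: "h \<in> Aut P L I"
  shows "\<exists>g\<in>Aut P L I. fst g \<circ> fst h = id \<and> snd g \<circ> snd h = id"
proof -
  obtain f where f: "bij_betw f P P" "\<forall>a. a \<notin> P \<longrightarrow> f a = a" "f \<circ> fst h = id" "fst h \<circ> f = id"
    using bij_betw_inverse[OF autD(1,2)[OF h]] by blast
  obtain k where k: "bij_betw k L L" "\<forall>l. l \<notin> L \<longrightarrow> k l = l" "k \<circ> snd h = id" "snd h \<circ> k = id"
    using bij_betw_inverse[OF autD(3,4)[OF h]] by blast
  have "I a l \<longleftrightarrow> I (f a) (k l)" if "a \<in> P" "l \<in> L" for a l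
  proof -
    have "f a \<in> P" "k l \<in> L" using bij_betwE[OF f(1)] bij_betwE[OF k(1)] that by auto
    then have "I (fst h (f a)) (snd h (k l)) \<longleftrightarrow> I (f a) (k l)" by (rule aut_inc[OF h])
    then show ?thesis using pointfree_idE[OF f(4)] pointfree_idE[OF k(4)] by simp
  qed
  then have "(f, k) \<in> Aut P L I" using f(1,2) k(1,2) unfolding Aut_def by blast
  then show ?thesis using f(3) k(3) by (intro bexI[of _ "(f, k)"]) auto
qed

lemma group_AutGroup: "group (AutGroup P L I)"
proof (rule groupI)
  fix g h k assume "g \<in> carrier (AutGroup P L I)" "h \<in> carrier (AutGroup P L I)"
    "k \<in> carrier (AutGroup P L I)"
  show "g \<otimes>\<^bsub>AutGroup P L I\<^esub> h \<otimes>\<^bsub>AutGroup P L I\<^esub> k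
      = g \<otimes>\<^bsub>AutGroup P L I\<^esub> (h \<otimes>\<^bsub>AutGroup P L I\<^esub> k)"
    by (simp add: comp_assoc)
next
  fix h assume "h \<in> carrier (AutGroup P L I)"
  then have h: "h \<in> Aut P L I" by simp
  show "\<one>\<^bsub>AutGroup P L I\<^esub> \<otimes>\<^bsub>AutGroup P L I\<^esub> h = h" by simp
  show "\<exists>g\<in>carrier (AutGroup P L I). g \<otimes>\<^bsub>AutGroup P L I\<^esub> h = \<one>\<^bsub>AutGroup P L I\<^esub>"
    using aut_inverse[OF h] by (auto simp: AutGroup_def)
  fix g assume "g \<in> carrier (AutGroup P L I)"
  then show "h \<otimes>\<^bsub>AutGroup P L I\<^esub> g \<in> carrier (AutGroup P L I)" using h by (simp add: aut_comp)
qed (simp add: Aut_def)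

text \<open>A moved point would share all its lines with its image, hence have only one line, while
  it has \<open>t + 1\<close>.\<close>

lemma fix_point_of_lines:
  assumes h: "h \<in> Aut P L I" and a: "a \<in> P" and t: "t > 0"
    and fix_lines: "\<And>l. \<lbrakk>l \<in> L; I a l\<rbrakk> \<Longrightarrow> snd h l = l"
  shows "fst h a = a"
proof (rule ccontr)
  assume ne: "fst h a \<noteq> a"
  have "l = m" if "l \<in> L" "I a l" "m \<in> L" "I a m" for l m
    using join_unique[OF a aut_point[OF h a] ne[symmetric], of l m] that
      aut_inc[OF h a] fix_lines by metis
  then have "card {l\<in>L. I a l} \<le> Suc 0"
    using finite_L by (subst card_le_Suc0_iff_eq) auto
  then show False using card_lines[OF a] t by simp
qed

lemma proj_equivariant:
  assumes h: "h \<in> Aut P L I" and a: "a \<in> P" and l: "l \<in> L" and n: "\<not> I a l"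
  shows "fst h (pr l a) = pr (snd h l) (fst h a)"
  using proj_props[OF a l n] a l n aut_point[OF h] aut_line[OF h] aut_inc[OF h] aut_col[OF h]
  by (intro proj_unique) auto

text \<open>Let \<open>c\<close> be the point of \<open>l\<close> collinear with \<open>a\<close>,
  and \<open>m\<close> the fixed line joining them. Then \<open>c\<close> is the projection of the
  fixed point \<open>b\<close> onto \<open>m\<close>, so \<open>c\<close> is fixed, and
  \<open>l\<close> joins the fixed points \<open>b\<close> and \<open>c\<close>.\<close>

lemma fix_lines_transfer:
  assumes h: "h \<in> Aut P L I" and a: "a \<in> P" and b: "b \<in> P" and n: "\<not> col a b"
    and fix_lines: "\<And>l. \<lbrakk>l \<in> L; I a l\<rbrakk> \<Longrightarrow> snd h l = l" and fb: "fst h b = b"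
    and l: "l \<in> L" "I b l"
  shows "snd h l = l"
proof -
  have al: "\<not> I a l" using colI[OF a b l(1)] l n by blast
  define c where "c = pr l a"
  have c: "c \<in> P" "I c l" "col a c" unfolding c_def using proj_props[OF a l(1) al] by auto
  obtain m where m: "m \<in> L" "I a m" "I c m" using c(3) by (rule colE)
  have bm: "\<not> I b m" using colI[OF a b m(1)] m n by blast
  have "c = pr m b" using proj_unique[OF b m(1) bm c(1) m(3)] colI[OF b c(1) l(1)] l c by blast
  then have hc: "fst h c = c"
    using proj_equivariant[OF h b m(1) bm] fb fix_lines[OF m(1,2)] by simp
  have "c \<noteq> b" using c n by blast
  then show ?thesis
    using join_unique[OF c(1) b, of "snd h l" l] aut_inc[OF h c(1) l(1)] aut_inc[OF h b l(1)]
      aut_line[OF h l(1)] hc fb c l by simp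
qed

end

section \<open>Skew translation generalized quadrangles\<close>

text \<open>The base point \<open>z\<close> is a parameter so that the locale can be entered again
  at another point not collinear with \<open>x\<close>.\<close>

locale skew_translation_gq = generalized_quadrangle P L I q q
  for P :: "'p set" and L :: "'l set" and I :: "'p \<Rightarrow> 'l \<Rightarrow> bool" and q :: nat +
  fixes x z :: 'p and H S :: "('p, 'l) autom set"
  assumes stgq: "is_STGQ P L I q q x H S" and q_odd: "odd q" and q_gt: "q > 1"
    and zP: "z \<in> P" and znc: "\<not> collinear P L I x z"
begin

abbreviation HG :: "('p, 'l) autom monoid" where
  "HG \<equiv> (AutGroup P L I)\<lparr>carrier := H\<rparr>"

definition lines_z :: "'l set" where "lines_z = {U\<in>L. I z U}"

abbreviation u :: "'l \<Rightarrow> 'p" where "u U \<equiv> pr U x"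

section \<open>The group \<open>H\<close> and its action\<close>

lemma xP: "x \<in> P" and H_sub: "subgroup H (AutGroup P L I)"
  and H_fix_lines: "\<lbrakk>h \<in> H; l \<in> L; I x l\<rbrakk> \<Longrightarrow> snd h l = l"
  and H_sharp: "\<lbrakk>a \<in> P; b \<in> P; \<not> col x a; \<not> col x b\<rbrakk> \<Longrightarrow> \<exists>!h. h \<in> H \<and> fst h a = b"
  and S_le_H: "S \<subseteq> H" and S_sub: "subgroup S (AutGroup P L I)" and card_S: "card S = q"
  and S_sym: "h \<in> S \<Longrightarrow> is_symmetry P L I x h"
  using stgq unfolding is_STGQ_def is_EGQ_def by blast+

lemma H_aut: "h \<in> H \<Longrightarrow> h \<in> Aut P L I"
  using subgroup.subset[OF H_sub] by auto

sublocale HG: group HG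
  using group.subgroup_imp_group[OF group_AutGroup H_sub] .

lemma HG_simps [simp]:
  "fst (g \<otimes>\<^bsub>HG\<^esub> h) = fst g \<circ> fst h" "snd (g \<otimes>\<^bsub>HG\<^esub> h) = snd g \<circ> snd h"
  "fst \<one>\<^bsub>HG\<^esub> = id" "snd \<one>\<^bsub>HG\<^esub> = id"
  by (simp_all add: AutGroup_def)

lemma inv_point:
  assumes "h \<in> H"
  shows "fst (inv\<^bsub>HG\<^esub> h) (fst h a) = a" "fst h (fst (inv\<^bsub>HG\<^esub> h) a) = a"
proof -
  have "fst (inv\<^bsub>HG\<^esub> h \<otimes>\<^bsub>HG\<^esub> h) = id" "fst (h \<otimes>\<^bsub>HG\<^esub> inv\<^bsub>HG\<^esub> h) = id"
    using HG.l_inv[of h] HG.r_inv[of h] assms HG_simps(3) by auto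
  then show "fst (inv\<^bsub>HG\<^esub> h) (fst h a) = a" "fst h (fst (inv\<^bsub>HG\<^esub> h) a) = a"
    unfolding HG_simps by (auto dest: pointfree_idE)
qed

lemma inv_line:
  assumes "h \<in> H"
  shows "snd (inv\<^bsub>HG\<^esub> h) (snd h l) = l" "snd h (snd (inv\<^bsub>HG\<^esub> h) l) = l"
proof -
  have "snd (inv\<^bsub>HG\<^esub> h \<otimes>\<^bsub>HG\<^esub> h) = id" "snd (h \<otimes>\<^bsub>HG\<^esub> inv\<^bsub>HG\<^esub> h) = id"
    using HG.l_inv[of h] HG.r_inv[of h] assms HG_simps(4) by auto
  then show "snd (inv\<^bsub>HG\<^esub> h) (snd h l) = l" "snd h (snd (inv\<^bsub>HG\<^esub> h) l) = l"
    unfolding HG_simps by (auto dest: pointfree_idE)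
qed

lemma H_closed:
  "\<lbrakk>g \<in> H; h \<in> H\<rbrakk> \<Longrightarrow> g \<otimes>\<^bsub>HG\<^esub> h \<in> H" "h \<in> H \<Longrightarrow> inv\<^bsub>HG\<^esub> h \<in> H" "\<one>\<^bsub>HG\<^esub> \<in> H"
  using HG.m_closed HG.inv_closed HG.one_closed by auto

lemma eq_of_inv_mult:
  assumes "g \<in> H" "h \<in> H" "inv\<^bsub>HG\<^esub> g \<otimes>\<^bsub>HG\<^esub> h = \<one>\<^bsub>HG\<^esub>"
  shows "g = h"
proof -
  have c: "g \<in> carrier HG" "h \<in> carrier HG" using assms by simp_all
  show ?thesis using HG.r_one[OF c(1)] HG.cancel_inv_left[OF c] unfolding assms(3) by (rule trans[OF sym])
qed

lemma H_fix_x: "h \<in> H \<Longrightarrow> fst h x = x"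
  using fix_point_of_lines[OF H_aut xP] H_fix_lines q_gt by simp

lemma H_col_x: "\<lbrakk>h \<in> H; a \<in> P\<rbrakk> \<Longrightarrow> col x (fst h a) \<longleftrightarrow> col x a"
  using aut_col[OF H_aut xP] H_fix_x by metis

lemma H_free:
  assumes "g \<in> H" "h \<in> H" "a \<in> P" "\<not> col x a" "fst g a = fst h a"
  shows "g = h"
  using H_sharp[of a "fst h a"] H_col_x aut_point[OF H_aut] assms by metis

lemma H_fix_one: "\<lbrakk>h \<in> H; a \<in> P; \<not> col x a; fst h a = a\<rbrakk> \<Longrightarrow> h = \<one>\<^bsub>HG\<^esub>"
  using H_free[of h "\<one>\<^bsub>HG\<^esub>" a] H_closed(3) HG_simps(3) by simp

lemma H_trans:
  assumes "a \<in> P" "b \<in> P" "\<not> col x a" "\<not> col x b"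
  obtains h where "h \<in> H" "fst h a = b"
  using H_sharp[OF assms] by blast

section \<open>The lines on \<open>z\<close> and the symmetries about \<open>x\<close>\<close>

lemma lines_zD:
  assumes "U \<in> lines_z"
  shows "U \<in> L" "I z U" "\<not> I x U" "u U \<in> P" "I (u U) U" "col x (u U)" "u U \<noteq> z" "u U \<noteq> x"
proof -
  show 1: "U \<in> L" "I z U" using assms by (auto simp: lines_z_def)
  show 2: "\<not> I x U" using colI[OF xP zP 1(1) _ 1(2)] znc by blast
  show 3: "u U \<in> P" "I (u U) U" "col x (u U)" using proj_props[OF xP 1(1) 2] by auto
  show "u U \<noteq> z" using 3 znc by metis
  show "u U \<noteq> x" using 3 2 by metis
qed

lemma card_lines_z: "card lines_z = q + 1"
  unfolding lines_z_def using card_lines[OF zP] .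

lemma u_not_on:
  assumes U: "U \<in> lines_z" and V: "V \<in> lines_z" and ne: "U \<noteq> V"
  shows "\<not> I (u U) V"
  using join_unique[OF lines_zD(4)[OF U] zP lines_zD(7)[OF U] lines_zD(1)[OF U] lines_zD(1)[OF V]]
    lines_zD[OF U] lines_zD[OF V] ne by blast

lemma on_line_noncol:
  assumes U: "U \<in> lines_z" and a: "a \<in> P" "I a U" "a \<noteq> u U"
  shows "\<not> col x a"
  using proj_unique[OF xP lines_zD(1)[OF U] lines_zD(3)[OF U] a(1,2)] a(3) by blast

lemma H_fix_u: "\<lbrakk>U \<in> lines_z; h \<in> H; snd h U = U\<rbrakk> \<Longrightarrow> fst h (u U) = u U"
  using proj_equivariant[OF H_aut xP lines_zD(1,3)] H_fix_x by simp

lemma other_line: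
  assumes "U \<in> lines_z"
  obtains V where "V \<in> lines_z" "V \<noteq> U"
proof -
  have "finite lines_z" using finite_L by (simp add: lines_z_def)
  then have "card (lines_z - {U}) = q" using card_lines_z assms by simp
  then have "lines_z - {U} \<noteq> {}" using q_gt by (metis card.empty not_less_zero)
  then show thesis using that by blast
qed

text \<open>Both \<open>z\<close> and its image lie on \<open>U\<close> and are collinear with
  \<open>u V\<close>, a point off \<open>U\<close>, so they coincide and sharp transitivity
  applies.\<close>

lemma fix_other_u_trivial:
  assumes U: "U \<in> lines_z" and V: "V \<in> lines_z" and ne: "V \<noteq> U"
    and h: "h \<in> H" "fst h (u V) = u V" "I (fst h z) U"
  shows "h = \<one>\<^bsub>HG\<^esub>"
proof -
  have hz: "fst h z \<in> P" using aut_point[OF H_aut[OF h(1)] zP] .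
  have 1: "col (u V) z" using colI lines_zD[OF V] zP by blast
  then have "col (u V) (fst h z)"
    using aut_col[OF H_aut[OF h(1)] lines_zD(4)[OF V] zP] h(2) by simp
  then have "fst h z = z"
    using no_triangle[OF lines_zD(4)[OF V] lines_zD(1)[OF U] u_not_on[OF V U ne] hz h(3) _ zP
        lines_zD(2)[OF U] 1] by blast
  then show ?thesis using H_fix_one h(1) zP znc by blast
qed

text \<open>A symmetry fixes every \<open>u V\<close>, so any line \<open>V\<close> on
  \<open>z\<close> other than \<open>U\<close> reduces this to
  \<open>fix_other_u_trivial\<close>.\<close>

lemma symmetry_fix_line:
  assumes U: "U \<in> lines_z" and h: "h \<in> H" "is_symmetry P L I x h" "snd h U = U"
  shows "h = \<one>\<^bsub>HG\<^esub>"
proof -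
  obtain V where V: "V \<in> lines_z" "V \<noteq> U" using other_line U by blast
  have "fst h (u V) = u V" using h(2) lines_zD[OF V(1)] by (simp add: is_symmetry_def)
  moreover have "I (fst h z) U"
    using aut_inc[OF H_aut[OF h(1)] zP lines_zD(1)[OF U]] h(3) lines_zD[OF U] by simp
  ultimately show ?thesis using fix_other_u_trivial[OF U V h(1)] by blast
qed

lemma axis_line:
  assumes "U \<in> lines_z"
  obtains m where "m \<in> L" "I x m" "I (u U) m" "m \<noteq> U"
  using lines_zD(3,6)[OF assms] by (metis colE)

text \<open>By \<open>symmetry_fix_line\<close> the action on the \<open>q\<close> lines on
  \<open>u U\<close> other than \<open>m\<close> is free. The set \<open>T\<close> is general
  because the lemma serves both for \<open>S\<close> and for the set of all symmetries in
  \<open>H\<close>.\<close>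

lemma symmetries_transitive:
  fixes T
  assumes U: "U \<in> lines_z" and m: "m \<in> L" "I x m" "I (u U) m"
    and T: "T \<subseteq> H" "\<And>h. h \<in> T \<Longrightarrow> is_symmetry P L I x h"
    and T_diff: "\<And>g h. \<lbrakk>g \<in> T; h \<in> T\<rbrakk> \<Longrightarrow> inv\<^bsub>HG\<^esub> g \<otimes>\<^bsub>HG\<^esub> h \<in> T"
  shows "card T \<le> q" and "card T = q \<Longrightarrow> (\<lambda>h. snd h U) ` T = {l\<in>L. I (u U) l} - {m}"
proof -
  have mU: "m \<noteq> U" using m lines_zD[OF U] by blast
  have inj: "inj_on (\<lambda>h. snd h U) T"
  proof (rule inj_onI)
    fix g h assume gh: "g \<in> T" "h \<in> T" "snd g U = snd h U"
    have H: "g \<in> H" "h \<in> H" using gh T by auto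
    have "snd (inv\<^bsub>HG\<^esub> g \<otimes>\<^bsub>HG\<^esub> h) U = U" using inv_line(1)[OF H(1), of U] gh(3) by simp
    then have "inv\<^bsub>HG\<^esub> g \<otimes>\<^bsub>HG\<^esub> h = \<one>\<^bsub>HG\<^esub>"
      using symmetry_fix_line[OF U] T_diff[OF gh(1,2)] T by blast
    then show "g = h" using eq_of_inv_mult H by blast
  qed
  let ?N = "{l\<in>L. I (u U) l} - {m}"
  have fin: "finite ?N" using finite_L by simp
  have card: "card ?N = q"
    using card_lines[OF lines_zD(4)[OF U]] m finite_L by simp
  have sub: "(\<lambda>h. snd h U) ` T \<subseteq> ?N"
  proof
    fix l assume "l \<in> (\<lambda>h. snd h U) ` T"
    then obtain h where h: "h \<in> T" "l = snd h U" by blast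
    have hH: "h \<in> H" using h T by blast
    have "fst h (u U) = u U" using T(2)[OF h(1)] lines_zD[OF U] by (simp add: is_symmetry_def)
    then have "I (u U) l"
      using aut_inc[OF H_aut[OF hH] lines_zD(4)[OF U] lines_zD(1)[OF U]] lines_zD(5)[OF U] h(2) by simp
    moreover have "l \<noteq> m"
      using aut_inj_line[OF H_aut[OF hH] lines_zD(1)[OF U] m(1)] H_fix_lines[OF hH m(1,2)] mU h(2) by auto
    ultimately show "l \<in> ?N" using aut_line[OF H_aut[OF hH] lines_zD(1)[OF U]] h(2) by simp
  qed
  show "card T \<le> q" using card_inj_on_le[OF inj sub fin] card by simp
  assume "card T = q"
  then show "(\<lambda>h. snd h U) ` T = ?N"
    using card_subset_eq[OF fin sub] card_image[OF inj] card by simp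
qed

lemma subgroup_S: "subgroup S HG"
  using group.subgroup_incl[OF group_AutGroup S_sub H_sub S_le_H] .

lemma symmetry_diff:
  assumes g: "g \<in> H" "is_symmetry P L I x g" and h: "h \<in> H" "is_symmetry P L I x h"
  shows "is_symmetry P L I x (inv\<^bsub>HG\<^esub> g \<otimes>\<^bsub>HG\<^esub> h)"
proof -
  have "fst (inv\<^bsub>HG\<^esub> g \<otimes>\<^bsub>HG\<^esub> h) a = a" if a: "a \<in> P" "col x a" for a
  proof -
    have e: "fst h a = a" "fst g a = a" using g(2) h(2) a by (auto simp: is_symmetry_def)
    have "fst (inv\<^bsub>HG\<^esub> g) (fst g a) = a" using inv_point(1)[OF g(1)] .
    then show ?thesis unfolding HG_simps comp_apply e .
  qed
  moreover have "inv\<^bsub>HG\<^esub> g \<otimes>\<^bsub>HG\<^esub> h \<in> Aut P L I"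
    using H_aut H_closed g(1) h(1) by blast
  ultimately show ?thesis unfolding is_symmetry_def by blast
qed

lemma ex_line_z: "\<exists>U. U \<in> lines_z"
  using card_lines_z by (metis Suc_eq_plus1 card.empty equals0I nat.distinct(1))

lemma finite_H: "finite H"
proof -
  have "inj_on (\<lambda>h. fst h z) H" using H_free[OF _ _ zP znc] by (rule inj_onI)
  moreover have "(\<lambda>h. fst h z) ` H \<subseteq> P" using aut_point H_aut zP by blast
  ultimately show ?thesis using finite_P inj_on_finite by blast
qed

text \<open>\<open>H\<close> contains at most \<open>q\<close> symmetries by freeness, and
  \<open>S\<close> already has that many. This description makes \<open>S\<close> invariant under
  conjugation.\<close>

lemma S_eq: "S = {h\<in>H. is_symmetry P L I x h}"
proof -
  let ?T = "{h\<in>H. is_symmetry P L I x h}"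
  obtain U where U: "U \<in> lines_z" using ex_line_z by blast
  obtain m where m: "m \<in> L" "I x m" "I (u U) m" using axis_line[OF U] by blast
  have "card ?T \<le> q"
  proof (rule symmetries_transitive(1)[OF U m])
    show "inv\<^bsub>HG\<^esub> g \<otimes>\<^bsub>HG\<^esub> h \<in> ?T" if "g \<in> ?T" "h \<in> ?T" for g h
    proof -
      have gh: "g \<in> H" "is_symmetry P L I x g" "h \<in> H" "is_symmetry P L I x h" using that by blast+
      show ?thesis using symmetry_diff[OF gh] H_closed(1)[OF H_closed(2)[OF gh(1)] gh(3)] by blast
    qed
  qed blast+
  moreover have "S \<subseteq> ?T" using S_le_H S_sym by blast
  moreover have "finite ?T" using finite_H by simp
  ultimately show ?thesis using card_S card_seteq by metis
qed

lemma S_normal: "S \<lhd> HG"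
  unfolding HG.normal_inv_iff
proof (intro conjI ballI)
  fix h s assume "h \<in> carrier HG" and s: "s \<in> S"
  then have h: "h \<in> H" by simp
  have sH: "s \<in> H" and ss: "is_symmetry P L I x s" using s S_eq by auto
  have "fst (h \<otimes>\<^bsub>HG\<^esub> s \<otimes>\<^bsub>HG\<^esub> inv\<^bsub>HG\<^esub> h) a = a" if a: "a \<in> P" "col x a" for a
  proof -
    have "fst (inv\<^bsub>HG\<^esub> h) a \<in> P" "col x (fst (inv\<^bsub>HG\<^esub> h) a)"
      using aut_point[OF H_aut[OF H_closed(2)[OF h]] a(1)] H_col_x[OF H_closed(2)[OF h] a(1)] a(2) by auto
    then have "fst s (fst (inv\<^bsub>HG\<^esub> h) a) = fst (inv\<^bsub>HG\<^esub> h) a" using ss by (simp add: is_symmetry_def)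
    then show ?thesis unfolding HG_simps comp_apply using inv_point(2)[OF h] by simp
  qed
  moreover have "h \<otimes>\<^bsub>HG\<^esub> s \<otimes>\<^bsub>HG\<^esub> inv\<^bsub>HG\<^esub> h \<in> H" using H_closed h sH by blast
  ultimately show "h \<otimes>\<^bsub>HG\<^esub> s \<otimes>\<^bsub>HG\<^esub> inv\<^bsub>HG\<^esub> h \<in> S"
    unfolding S_eq is_symmetry_def using H_aut by blast
qed (rule subgroup_S)

lemma S_transitive:
  assumes U: "U \<in> lines_z" and m: "m \<in> L" "I x m" "I (u U) m"
  shows "(\<lambda>s. snd s U) ` S = {l\<in>L. I (u U) l} - {m}"
proof (rule symmetries_transitive(2)[OF U m S_le_H S_sym _ card_S])
  show "inv\<^bsub>HG\<^esub> g \<otimes>\<^bsub>HG\<^esub> h \<in> S" if "g \<in> S" "h \<in> S" for g h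
    using HG.subgroup_closed(3)[OF subgroup_S HG.subgroup_closed(4)[OF subgroup_S that(1)] that(2)] .
qed

section \<open>Stabilizers of lines and points\<close>

lemma HG_subgroupI:
  assumes "K \<subseteq> H" "\<one>\<^bsub>HG\<^esub> \<in> K" "\<And>h. h \<in> K \<Longrightarrow> inv\<^bsub>HG\<^esub> h \<in> K"
    "\<And>g h. \<lbrakk>g \<in> K; h \<in> K\<rbrakk> \<Longrightarrow> g \<otimes>\<^bsub>HG\<^esub> h \<in> K"
  shows "subgroup K HG"
proof (rule HG.subgroupI)
  show "K \<subseteq> carrier HG" using assms(1) by simp
  show "K \<noteq> {}" using assms(2) by blast
qed (use assms(3,4) in blast)+

lemma subgroup_stab_line: "subgroup (stab_line H l) HG"
proof (rule HG_subgroupI)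
  fix h assume "h \<in> stab_line H l"
  then have h: "h \<in> H" "snd h l = l" unfolding stab_line_def by blast+
  have "snd (inv\<^bsub>HG\<^esub> h) l = l"
    using inv_line(1)[OF h(1), of l] unfolding h(2) .
  then show "inv\<^bsub>HG\<^esub> h \<in> stab_line H l" using H_closed(2)[OF h(1)] unfolding stab_line_def by blast
next
  fix g h assume "g \<in> stab_line H l" "h \<in> stab_line H l"
  then have gh: "g \<in> H" "snd g l = l" "h \<in> H" "snd h l = l" unfolding stab_line_def by blast+
  have "snd (g \<otimes>\<^bsub>HG\<^esub> h) l = l" unfolding HG_simps comp_apply gh ..
  then show "g \<otimes>\<^bsub>HG\<^esub> h \<in> stab_line H l"
    using H_closed(1)[OF gh(1,3)] unfolding stab_line_def by blast
next
  show "\<one>\<^bsub>HG\<^esub> \<in> stab_line H l"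
    unfolding stab_line_def using H_closed(3) HG_simps(4) by (metis (mono_tags, lifting) id_apply mem_Collect_eq)
qed (auto simp: stab_line_def)

lemma subgroup_stab_pt: "subgroup (stab_pt H a) HG"
proof (rule HG_subgroupI)
  fix h assume "h \<in> stab_pt H a"
  then have h: "h \<in> H" "fst h a = a" unfolding stab_pt_def by blast+
  have "fst (inv\<^bsub>HG\<^esub> h) a = a"
    using inv_point(1)[OF h(1), of a] unfolding h(2) .
  then show "inv\<^bsub>HG\<^esub> h \<in> stab_pt H a" using H_closed(2)[OF h(1)] unfolding stab_pt_def by blast
next
  fix g h assume "g \<in> stab_pt H a" "h \<in> stab_pt H a"
  then have gh: "g \<in> H" "fst g a = a" "h \<in> H" "fst h a = a" unfolding stab_pt_def by blast+
  have "fst (g \<otimes>\<^bsub>HG\<^esub> h) a = a" unfolding HG_simps comp_apply gh ..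
  then show "g \<otimes>\<^bsub>HG\<^esub> h \<in> stab_pt H a"
    using H_closed(1)[OF gh(1,3)] unfolding stab_pt_def by blast
next
  show "\<one>\<^bsub>HG\<^esub> \<in> stab_pt H a"
    unfolding stab_pt_def using H_closed(3) HG_simps(3) by (metis (mono_tags, lifting) id_apply mem_Collect_eq)
qed (auto simp: stab_pt_def)

text \<open>Some \<open>h\<close> in \<open>H\<close> sends \<open>z\<close> to \<open>w\<close>. It
  fixes the line \<open>m\<close> from \<open>x\<close> to \<open>u U\<close>. The point
  \<open>u U\<close> and its image are points of \<open>m\<close> collinear with \<open>w\<close>,
  so \<open>u U\<close> is fixed, and with it the line \<open>U\<close>, whose image joins
  \<open>w\<close> and \<open>u U\<close>.\<close>

lemma stab_line_transitive:
  assumes U: "U \<in> lines_z" and w: "w \<in> P" "I w U" "w \<noteq> u U"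
  obtains h where "h \<in> stab_line H U" "fst h z = w"
proof -
  have nw: "\<not> col x w" using on_line_noncol[OF U w] .
  obtain h where h: "h \<in> H" "fst h z = w" using H_trans[OF zP w(1) znc nw] by blast
  note ha = H_aut[OF h(1)]
  obtain m where m: "m \<in> L" "I x m" "I (u U) m" using axis_line[OF U] by blast
  have uU: "u U \<in> P" "I (u U) U" "U \<in> L" "I z U" using lines_zD[OF U] by auto
  have v: "fst h (u U) \<in> P" "I (fst h (u U)) m" "I (fst h (u U)) (snd h U)" "snd h U \<in> L"
    using aut_point[OF ha uU(1)] aut_inc[OF ha uU(1) m(1)] aut_inc[OF ha uU(1,3)]
      H_fix_lines[OF h(1) m(1,2)] m uU aut_line[OF ha uU(3)] by auto
  have wU: "I w (snd h U)" using aut_inc[OF ha zP uU(3)] uU(4) h(2) by simp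
  have wm: "\<not> I w m" using colI[OF xP w(1) m(1,2)] nw by blast
  have "fst h (u U) = u U"
    using no_triangle[OF w(1) m(1) wm v(1,2) colI[OF w(1) v(1,4) wU v(3)] uU(1) m(3)
        colI[OF w(1) uU(1) uU(3) w(2) uU(2)]] .
  then have "snd h U = U"
    using join_unique[OF w(1) uU(1) w(3) v(4) uU(3) wU _ w(2) uU(2)] v(3) by simp
  then show thesis using that h by (simp add: stab_line_def)
qed

text \<open>The action on the \<open>q\<close> points of \<open>U\<close> other than
  \<open>u U\<close> is free and transitive.\<close>

lemma card_stab_line:
  assumes U: "U \<in> lines_z"
  shows "card (stab_line H U) = q"
proof -
  have uU: "u U \<in> P" "I (u U) U" "U \<in> L" "I z U" using lines_zD[OF U] by auto
  have inj: "inj_on (\<lambda>h. fst h z) (stab_line H U)"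
    by (rule inj_onI, rule H_free[OF _ _ zP znc]) (simp_all add: stab_line_def)
  have "(\<lambda>h. fst h z) ` stab_line H U = {w\<in>P. I w U} - {u U}"
  proof
    show "(\<lambda>h. fst h z) ` stab_line H U \<subseteq> {w\<in>P. I w U} - {u U}"
    proof
      fix w assume "w \<in> (\<lambda>h. fst h z) ` stab_line H U"
      then obtain h where h: "h \<in> H" "snd h U = U" "w = fst h z" by (auto simp: stab_line_def)
      note ha = H_aut[OF h(1)]
      have "w \<noteq> u U"
        using aut_inj_point[OF ha zP uU(1)] H_fix_u[OF U h(1,2)] lines_zD(7)[OF U] h(3) by auto
      then show "w \<in> {w\<in>P. I w U} - {u U}"
        using aut_point[OF ha zP] aut_inc[OF ha zP uU(3)] uU(4) h by simp
    qed
    show "{w\<in>P. I w U} - {u U} \<subseteq> (\<lambda>h. fst h z) ` stab_line H U"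
    proof
      fix w assume "w \<in> {w\<in>P. I w U} - {u U}"
      then have "w \<in> P" "I w U" "w \<noteq> u U" by auto
      then obtain h where "h \<in> stab_line H U" "fst h z = w" using stab_line_transitive[OF U] by blast
      then show "w \<in> (\<lambda>h. fst h z) ` stab_line H U" by blast
    qed
  qed
  moreover have "card ({w\<in>P. I w U} - {u U}) = q"
    using card_points[OF uU(3)] finite_P uU by simp
  ultimately show ?thesis using card_image[OF inj] by simp
qed

text \<open>\<open>S\<close> is transitive on the lines on \<open>u U\<close> other than the one
  through \<open>x\<close>, so every element fixing \<open>u U\<close> can be corrected by
  \<open>S\<close> to fix \<open>U\<close>.\<close>

lemma stab_pt_eq:
  assumes U: "U \<in> lines_z"
  shows "stab_pt H (u U) = stab_line H U <#>\<^bsub>HG\<^esub> S"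
proof
  have uU: "u U \<in> P" "I (u U) U" "U \<in> L" using lines_zD[OF U] by auto
  obtain m where m: "m \<in> L" "I x m" "I (u U) m" "m \<noteq> U" using axis_line[OF U] by blast
  show "stab_pt H (u U) \<subseteq> stab_line H U <#>\<^bsub>HG\<^esub> S"
  proof
    fix h assume h: "h \<in> stab_pt H (u U)"
    \<comment> \<open>Working with the inverse puts the correction on the right: \<open>s\<close>
      and \<open>g\<close> agree on \<open>U\<close>, hence the product of \<open>h\<close> and
      \<open>s\<close> fixes it.\<close>
    define g where "g = inv\<^bsub>HG\<^esub> h"
    have g: "g \<in> H" "fst g (u U) = u U"
      using HG.subgroup_closed(4)[OF subgroup_stab_pt h] unfolding g_def stab_pt_def by blast+
    note ga = H_aut[OF g(1)]
    have "I (u U) (snd g U)" using aut_inc[OF ga uU(1,3)] uU(2) unfolding g(2) by blast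
    moreover have "snd g U \<noteq> m"
      using aut_inj_line[OF ga uU(3) m(1)] m(4) unfolding H_fix_lines[OF g(1) m(1,2)] by metis
    ultimately have "snd g U \<in> {l\<in>L. I (u U) l} - {m}" using aut_line[OF ga uU(3)] by blast
    then have "snd g U \<in> (\<lambda>s. snd s U) ` S" unfolding S_transitive[OF U m(1-3)] .
    then obtain s where s: "s \<in> S" "snd s U = snd g U" by (metis imageE)
    have sH: "s \<in> H" using s(1) S_le_H by blast
    define a where "a = h \<otimes>\<^bsub>HG\<^esub> s"
    have hH: "h \<in> H" using h unfolding stab_pt_def by blast
    have "snd a U = U"
      unfolding a_def HG_simps comp_apply s(2) g_def by (rule inv_line(2)[OF hH])
    then have 1: "a \<in> stab_line H U" using H_closed(1)[OF hH sH] unfolding stab_line_def a_def by blast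
    have 2: "h = a \<otimes>\<^bsub>HG\<^esub> inv\<^bsub>HG\<^esub> s"
    proof -
      have c: "h \<in> carrier HG" "s \<in> carrier HG" using hH sH by simp_all
      show ?thesis
        unfolding a_def HG.m_assoc[OF c HG.inv_closed[OF c(2)]] HG.r_inv[OF c(2)] HG.r_one[OF c(1)] ..
    qed
    have 3: "inv\<^bsub>HG\<^esub> s \<in> S" using HG.subgroup_closed(4)[OF subgroup_S s(1)] .
    show "h \<in> stab_line H U <#>\<^bsub>HG\<^esub> S"
      unfolding set_mult_def by (rule UN_I[OF 1 UN_I[OF 3]]) (simp only: 2[symmetric] singleton_iff)
  qed
  have "stab_line H U \<subseteq> stab_pt H (u U)"
    unfolding stab_line_def stab_pt_def using H_fix_u[OF U] by blast
  moreover have "S \<subseteq> stab_pt H (u U)"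
  proof
    fix s assume "s \<in> S"
    then have "s \<in> H" "fst s (u U) = u U"
      using S_le_H S_sym lines_zD(4,6)[OF U] unfolding is_symmetry_def by blast+
    then show "s \<in> stab_pt H (u U)" unfolding stab_pt_def by blast
  qed
  ultimately have "a \<otimes>\<^bsub>HG\<^esub> s \<in> stab_pt H (u U)" if "a \<in> stab_line H U" "s \<in> S" for a s
    using HG.subgroup_closed(3)[OF subgroup_stab_pt, of a "u U" s] that by blast
  then show "stab_line H U <#>\<^bsub>HG\<^esub> S \<subseteq> stab_pt H (u U)"
    by (intro subsetI) (auto simp only: set_mult_def UN_iff singleton_iff)
qed

text \<open>Orbit counting: \<open>u U\<close> can only move within the \<open>q\<close> points of
  \<open>m\<close> other than \<open>x\<close>, and the elements with a given image lie in a coset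
  of its stabilizer, of size at most \<open>q * q\<close>.\<close>

lemma card_H_le: "card H \<le> q ^ 3"
proof -
  obtain U where U: "U \<in> lines_z" using ex_line_z by blast
  have uU: "u U \<in> P" using lines_zD[OF U] by auto
  obtain m where m: "m \<in> L" "I x m" "I (u U) m" "m \<noteq> U" using axis_line[OF U] by blast
  let ?St = "stab_pt H (u U)" and ?M = "{v\<in>P. I v m} - {x}"
  have finSt: "finite ?St" using finite_H by (simp add: stab_pt_def)
  have "?St = (\<lambda>(a, s). a \<otimes>\<^bsub>HG\<^esub> s) ` (stab_line H U \<times> S)"
    unfolding stab_pt_eq[OF U] set_mult_def by auto
  moreover have "finite (stab_line H U \<times> S)"
    using finite_H finite_subset[OF S_le_H] by (simp add: stab_line_def)
  ultimately have "card ?St \<le> card (stab_line H U \<times> S)" using card_image_le by metis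
  then have cardSt: "card ?St \<le> q * q"
    using card_stab_line[OF U] card_S by (simp add: card_cartesian_product)
  have fibre: "card {h\<in>H. fst h (u U) = v} \<le> q * q" for v
  proof (cases "{h\<in>H. fst h (u U) = v} = {}")
    case False
    then obtain g where g: "g \<in> H" "fst g (u U) = v" by blast
    have "inj_on (\<lambda>h. inv\<^bsub>HG\<^esub> g \<otimes>\<^bsub>HG\<^esub> h) {h\<in>H. fst h (u U) = v}"
    proof (rule inj_on_subset)
      show "inj_on (\<lambda>h. inv\<^bsub>HG\<^esub> g \<otimes>\<^bsub>HG\<^esub> h) (carrier HG)"
        using H_closed(2)[OF g(1)] by (intro HG.inj_on_cmult) simp
    qed auto
    moreover have "(\<lambda>h. inv\<^bsub>HG\<^esub> g \<otimes>\<^bsub>HG\<^esub> h) ` {h\<in>H. fst h (u U) = v} \<subseteq> ?St"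
    proof
      fix k assume "k \<in> (\<lambda>h. inv\<^bsub>HG\<^esub> g \<otimes>\<^bsub>HG\<^esub> h) ` {h\<in>H. fst h (u U) = v}"
      then obtain h where h: "h \<in> H" "fst h (u U) = v" "k = inv\<^bsub>HG\<^esub> g \<otimes>\<^bsub>HG\<^esub> h" by blast
      have "fst k (u U) = fst (inv\<^bsub>HG\<^esub> g) (fst g (u U))"
        unfolding h(3) HG_simps comp_apply h(2) g(2) ..
      then show "k \<in> ?St"
        using inv_point(1)[OF g(1)] H_closed h(1,3) g(1) by (simp add: stab_pt_def)
    qed
    ultimately show ?thesis using card_inj_on_le finSt cardSt le_trans by blast
  qed (simp only: card.empty le0)
  have "H = (\<Union>v\<in>?M. {h\<in>H. fst h (u U) = v})"
  proof -
    have "fst h (u U) \<in> ?M" if h: "h \<in> H" for h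
    proof -
      note ha = H_aut[OF h]
      have "fst h (u U) \<noteq> x"
        using aut_inj_point[OF ha uU xP] H_fix_x[OF h] lines_zD(8)[OF U] by auto
      then show ?thesis
        using aut_point[OF ha uU] aut_inc[OF ha uU m(1)] H_fix_lines[OF h m(1,2)] m(3) by simp
    qed
    then show ?thesis by blast
  qed
  then have "card H = card (\<Union>v\<in>?M. {h\<in>H. fst h (u U) = v})" by simp
  also have "\<dots> \<le> (\<Sum>v\<in>?M. card {h\<in>H. fst h (u U) = v})"
    using finite_P by (intro card_UN_le) simp
  also have "\<dots> \<le> (\<Sum>v\<in>?M. q * q)" by (rule sum_mono[OF fibre])
  also have "\<dots> = q ^ 3"
    using card_points[OF m(1)] finite_P xP m(2) by (simp add: power3_eq_cube)
  finally show ?thesis .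
qed

text \<open>For \<open>K2\<close>, the product of \<open>b\<close> and \<open>s\<close> fixes
  \<open>u V\<close>, so \<open>fix_other_u_trivial\<close> applies. For \<open>K1\<close>, if
  \<open>c\<close> moved \<open>z\<close>, the image would be collinear with both \<open>z\<close>
  and \<open>fst a z\<close> on \<open>U\<close>; then \<open>a\<close> is trivial, and
  \<open>c = b\<close> sends \<open>z\<close> to the common point of \<open>V\<close> and
  \<open>W\<close>, which is \<open>z\<close>.\<close>

sublocale K: skew_kantor HG lines_z "stab_line H" S q
proof (intro skew_kantor.intro skew_kantor_axioms.intro)
  show "group HG" by (rule HG.is_group)
  show "finite (carrier HG)" using finite_H by simp
  show "card (carrier HG) \<le> q ^ 3" using card_H_le by simp
  show "card lines_z = q + 1" by (rule card_lines_z)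
  show "odd q" by (rule q_odd)
  show "q > 1" by (rule q_gt)
  show "S \<lhd> HG" by (rule S_normal)
  show "card S = q" by (rule card_S)
  show "subgroup (stab_line H U) HG" if "U \<in> lines_z" for U by (rule subgroup_stab_line)
  show "card (stab_line H U) = q" if "U \<in> lines_z" for U using that by (rule card_stab_line)
next
  fix U V a b s
  assume U: "U \<in> lines_z" and V: "V \<in> lines_z" and ne: "U \<noteq> V"
    and a: "a \<in> stab_line H U" and b: "b \<in> stab_line H V" and s: "s \<in> S"
    and eq: "b \<otimes>\<^bsub>HG\<^esub> s = a"
  have aH: "a \<in> H" "snd a U = U" using a by (auto simp: stab_line_def)
  have "a \<in> stab_pt H (u V)"
    unfolding stab_pt_eq[OF V] eq[symmetric] using b s by (auto simp: set_mult_def)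
  then have "fst a (u V) = u V" by (simp add: stab_pt_def)
  moreover have "I (fst a z) U"
    using aut_inc[OF H_aut[OF aH(1)] zP lines_zD(1)[OF U]] aH(2) lines_zD(2)[OF U] by simp
  ultimately show "a = \<one>\<^bsub>HG\<^esub>" using fix_other_u_trivial[OF U V ne[symmetric] aH(1)] by blast
next
  fix U V W a b c
  assume J: "U \<in> lines_z" "V \<in> lines_z" "W \<in> lines_z" and ne: "U \<noteq> V" "U \<noteq> W" "V \<noteq> W"
    and a: "a \<in> stab_line H U" and b: "b \<in> stab_line H V" and c: "c \<in> stab_line H W"
    and eq: "a \<otimes>\<^bsub>HG\<^esub> b = c"
  have H: "a \<in> H" "b \<in> H" "c \<in> H" and fx: "snd a U = U" "snd b V = V" "snd c W = W"
    using a b c by (auto simp: stab_line_def)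
  note au = H_aut[OF H(1)] H_aut[OF H(2)] H_aut[OF H(3)]
  have pts: "fst a z \<in> P" "fst b z \<in> P" "fst c z \<in> P" using aut_point au zP by auto
  have on: "I (fst a z) U" "I (fst b z) V" "I (fst c z) W"
    using aut_inc[OF au(1) zP lines_zD(1)[OF J(1)]] aut_inc[OF au(2) zP lines_zD(1)[OF J(2)]]
      aut_inc[OF au(3) zP lines_zD(1)[OF J(3)]] fx lines_zD(2) J by auto
  have cz: "fst c z = fst a (fst b z)" unfolding eq[symmetric] HG_simps comp_apply ..
  have on_two: "w = z" if "w \<in> P" "I w l" "I w k" "l \<in> lines_z" "k \<in> lines_z" "l \<noteq> k" for w l k
    using join_unique[OF that(1) zP _ lines_zD(1)[OF that(4)] lines_zD(1)[OF that(5)] that(2)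
        lines_zD(2)[OF that(4)] that(3) lines_zD(2)[OF that(5)]] that(6) by blast
  show "c = \<one>\<^bsub>HG\<^esub>"
  proof (cases "fst c z = z")
    case True
    then show ?thesis using H_fix_one[OF H(3) zP znc] by blast
  next
    case False
    then have nU: "\<not> I (fst c z) U" using on_two[OF pts(3) _ on(3) J(1,3) ne(2)] by blast
    have "col (fst b z) z" using colI[OF pts(2) zP lines_zD(1)[OF J(2)] on(2)] lines_zD(2)[OF J(2)] by blast
    then have "col (fst c z) (fst a z)" unfolding cz using aut_col[OF au(1) pts(2) zP] by blast
    moreover have "col (fst c z) z"
      using colI[OF pts(3) zP lines_zD(1)[OF J(3)] on(3)] lines_zD(2)[OF J(3)] by blast
    ultimately have "fst a z = z"
      using no_triangle[OF pts(3) lines_zD(1)[OF J(1)] nU pts(1) on(1) _ zP lines_zD(2)[OF J(1)]] by blast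
    then have "a = \<one>\<^bsub>HG\<^esub>" using H_fix_one[OF H(1) zP znc] by blast
    then have "c = b" using eq HG.l_one[of b] H(2) by simp
    then show ?thesis using on_two[OF pts(3) on(3) _ J(3,2)] on(2) ne(3) False by blast
  qed
qed

section \<open>Geometric meaning of the abstract Kantor family\<close>

lemma K_B_eq: "U \<in> lines_z \<Longrightarrow> K.B U = stab_pt H (u U)"
  by (simp add: K.B_def stab_pt_eq)

lemma kantor_Fstar_eq: "kantor_Fstar P L I x H z = K.B ` lines_z"
proof -
  have "kantor_Fstar P L I x H z = (\<lambda>U. stab_pt H (u U)) ` lines_z"
    unfolding kantor_Fstar_def lines_z_def by blast
  also have "\<dots> = K.B ` lines_z" by (rule image_cong) (simp_all only: K_B_eq)
  finally show ?thesis .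
qed

text \<open>The stabilizer of \<open>u U\<close> is \<open>K.B U\<close> and therefore normal in
  \<open>H\<close>, so it fixes the whole orbit of \<open>u U\<close>; this orbit contains each
  point of \<open>m\<close> other than \<open>x\<close>.\<close>

lemma stab_pt_fixes_axis:
  assumes U: "U \<in> lines_z" and m: "m \<in> L" "I x m" "I (u U) m"
    and h: "h \<in> stab_pt H (u U)" and c: "c \<in> P" "I c m"
  shows "fst h c = c"
proof (cases "c = x")
  case True
  then show ?thesis using H_fix_x h by (simp add: stab_pt_def)
next
  case False
  have hH: "h \<in> H" using h by (simp add: stab_pt_def)
  have uU: "u U \<in> P" "I (u U) U" "U \<in> L" "I z U" using lines_zD[OF U] by auto
  have zm: "\<not> I z m" using colI[OF xP zP m(1,2)] znc by blast
  have "card {l\<in>L. I c l} = q + 1" using card_lines[OF c(1)] .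
  then have "\<not> {l\<in>L. I c l} \<subseteq> {m}" using q_gt card_mono[of "{m}" "{l\<in>L. I c l}"] by auto
  \<comment> \<open>A further point \<open>w\<close> on a line \<open>N\<close> through
    \<open>c\<close> is not collinear with \<open>x\<close> and projects to \<open>c\<close> on
    \<open>m\<close>. An element of \<open>H\<close> from \<open>z\<close> to \<open>w\<close> then
    carries \<open>u U\<close> to \<open>c\<close>.\<close>
  then obtain N where N: "N \<in> L" "I c N" "N \<noteq> m" by blast
  have xN: "\<not> I x N" using join_unique[OF xP c(1) False[symmetric] N(1) m(1) _ N(2) m(2) c(2)] N(3) by blast
  have "card {a\<in>P. I a N} = q + 1" using card_points[OF N(1)] .
  then have "\<not> {a\<in>P. I a N} \<subseteq> {c}" using q_gt card_mono[of "{c}" "{a\<in>P. I a N}"] by auto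
  then obtain w where w: "w \<in> P" "I w N" "w \<noteq> c" by blast
  have xw: "\<not> col x w"
    using no_triangle[OF xP N(1) xN w(1,2) _ c(1) N(2) colI[OF xP c(1) m(1,2) c(2)]] w(3) by blast
  have wm: "\<not> I w m" using colI[OF xP w(1) m(1,2)] xw by blast
  obtain g where g: "g \<in> H" "fst g z = w" using H_trans[OF zP w(1) znc xw] by blast
  note ga = H_aut[OF g(1)]
  have "u U = pr m z" using proj_unique[OF zP m(1) zm uU(1) m(3) colI[OF zP uU(1,3,4,2)]] .
  then have "fst g (u U) = pr m w"
    using proj_equivariant[OF ga zP m(1) zm] H_fix_lines[OF g(1) m(1,2)] g(2) by simp
  also have "\<dots> = c" using proj_unique[OF w(1) m(1) wm c colI[OF w(1) c(1) N(1) w(2) N(2)]] by simp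
  finally have gc: "fst g (u U) = c" .
  have gi: "inv\<^bsub>HG\<^esub> g \<in> carrier HG" "inv\<^bsub>HG\<^esub> (inv\<^bsub>HG\<^esub> g) = g"
    using H_closed(2)[OF g(1)] HG.inv_inv[of g] g(1) by simp_all
  have "h \<in> K.B U" using h K_B_eq[OF U] by blast
  then have "inv\<^bsub>HG\<^esub> g \<otimes>\<^bsub>HG\<^esub> h \<otimes>\<^bsub>HG\<^esub> g \<in> stab_pt H (u U)"
    using K.B_conj[OF U gi(1)] unfolding gi(2) K_B_eq[OF U] by blast
  then have "fst (inv\<^bsub>HG\<^esub> g \<otimes>\<^bsub>HG\<^esub> h \<otimes>\<^bsub>HG\<^esub> g) (u U) = u U" unfolding stab_pt_def by blast
  then have "fst (inv\<^bsub>HG\<^esub> g) (fst h c) = u U" unfolding HG_simps comp_apply gc .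
  then have "fst g (fst (inv\<^bsub>HG\<^esub> g) (fst h c)) = fst g (u U)" by (rule arg_cong)
  then show ?thesis unfolding inv_point(2)[OF g(1)] gc .
qed

section \<open>Centrality of \<open>S\<close> and condition M\<close>

lemma center_S_iff: "S \<subseteq> center HG \<longleftrightarrow> (\<forall>s\<in>S. \<forall>g\<in>H. s \<otimes>\<^bsub>HG\<^esub> g = g \<otimes>\<^bsub>HG\<^esub> s)"
proof -
  have "center HG = {s\<in>H. \<forall>g\<in>H. s \<otimes>\<^bsub>HG\<^esub> g = g \<otimes>\<^bsub>HG\<^esub> s}"
    unfolding center_def partial_object.select_convs partial_object.update_convs by simp
  then show ?thesis using S_le_H by (auto simp only: subset_iff mem_Collect_eq)
qed

text \<open>The lines on \<open>u U\<close> other than \<open>m\<close> are the images of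
  \<open>U\<close> under \<open>S\<close>, and \<open>h\<close> fixes \<open>U\<close> and commutes
  with \<open>S\<close>.\<close>

lemma central_S_fixes_lines:
  assumes c: "S \<subseteq> center HG" and U: "U \<in> lines_z"
    and h: "h \<in> stab_line H U" and l: "l \<in> L" "I (u U) l"
  shows "snd h l = l"
proof -
  obtain m where m: "m \<in> L" "I x m" "I (u U) m" "m \<noteq> U" using axis_line[OF U] by blast
  have hH: "h \<in> H" "snd h U = U" using h unfolding stab_line_def by blast+
  show ?thesis
  proof (cases "l = m")
    case True
    then show ?thesis using H_fix_lines[OF hH(1) m(1,2)] by simp
  next
    case False
    then have "l \<in> (\<lambda>s. snd s U) ` S" unfolding S_transitive[OF U m(1-3)] using l by simp
    then obtain s where s: "s \<in> S" "l = snd s U" by (rule imageE)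
    have "s \<otimes>\<^bsub>HG\<^esub> h = h \<otimes>\<^bsub>HG\<^esub> s" using c hH(1) s(1) unfolding center_S_iff by blast
    then have "snd (s \<otimes>\<^bsub>HG\<^esub> h) U = snd (h \<otimes>\<^bsub>HG\<^esub> s) U" by (rule arg_cong)
    then show ?thesis unfolding HG_simps comp_apply hH(2) s(2) by (rule sym)
  qed
qed

text \<open>The commutator \<open>k\<close> is in \<open>S\<close> by normality, and it fixes
  \<open>U\<close> because \<open>h\<close> fixes both \<open>U\<close> and its image under
  \<open>s\<close>. A symmetry fixing \<open>U\<close> is trivial.\<close>

lemma fixes_lines_commute:
  assumes U: "U \<in> lines_z" and h: "h \<in> stab_line H U"
    and fl: "\<And>l. \<lbrakk>l \<in> L; I (u U) l\<rbrakk> \<Longrightarrow> snd h l = l" and s: "s \<in> S"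
  shows "h \<otimes>\<^bsub>HG\<^esub> s = s \<otimes>\<^bsub>HG\<^esub> h"
proof -
  have hH: "h \<in> H" "snd h U = U" using h unfolding stab_line_def by blast+
  have sH: "s \<in> H" using s S_le_H by blast
  have uU: "u U \<in> P" "I (u U) U" "U \<in> L" using lines_zD[OF U] by auto
  have c: "h \<in> carrier HG" "s \<in> carrier HG" using hH sH by simp_all
  note ic = HG.inv_closed[OF c(1)] HG.inv_closed[OF c(2)]
  define k where "k = inv\<^bsub>HG\<^esub> h \<otimes>\<^bsub>HG\<^esub> inv\<^bsub>HG\<^esub> s \<otimes>\<^bsub>HG\<^esub> h \<otimes>\<^bsub>HG\<^esub> s"
  have "k \<in> S"
    unfolding k_def
    using HG.subgroup_closed(3)[OF subgroup_S K.S_conj'[OF c(1) HG.subgroup_closed(4)[OF subgroup_S s]] s] .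
  then have k: "k \<in> H" "is_symmetry P L I x k" using S_le_H S_sym by blast+
  have "fst s (u U) = u U" using S_sym[OF s] lines_zD(4,6)[OF U] unfolding is_symmetry_def by blast
  then have "I (u U) (snd s U)" using aut_inc[OF H_aut[OF sH] uU(1,3)] uU(2) by simp
  then have hs: "snd h (snd s U) = snd s U" using fl aut_line[OF H_aut[OF sH] uU(3)] by blast
  have "snd (inv\<^bsub>HG\<^esub> h) (snd h U) = U" by (rule inv_line(1)[OF hH(1)])
  then have "snd (inv\<^bsub>HG\<^esub> h) U = U" unfolding hH(2) .
  then have "snd k U = U"
    unfolding k_def HG_simps comp_apply hs inv_line(1)[OF sH] .
  then have k1: "k = \<one>\<^bsub>HG\<^esub>" by (rule symmetry_fix_line[OF U k])
  have "h \<otimes>\<^bsub>HG\<^esub> s = s \<otimes>\<^bsub>HG\<^esub> h \<otimes>\<^bsub>HG\<^esub> k"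
    unfolding k_def using c ic HG.m_closed
    by (simp only: HG.m_assoc HG.cancel_inv_left HG.m_closed)
  then show ?thesis unfolding k1 using HG.r_one[OF HG.m_closed[OF c(2,1)]] by simp
qed

text \<open>The automorphism given by condition \<open>(M)\<^sub>x\<close> need not lie in \<open>H\<close>; this lemma is used to compare it with
  an element of \<open>H\<close>. The proof finds a fixed point \<open>a\<close> on a second line \<open>V\<close> on \<open>z\<close>, and transfers the
  property of having all lines fixed from \<open>x\<close> to \<open>a\<close> and from \<open>a\<close> to \<open>u U\<close>.\<close>

lemma rigidity:
  assumes U: "U \<in> lines_z" and m: "m \<in> L" "I x m" "I (u U) m"
    and f: "f \<in> Aut P L I" and fx: "\<And>l. \<lbrakk>l \<in> L; I x l\<rbrakk> \<Longrightarrow> snd f l = l"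
    and fm: "\<And>a. \<lbrakk>a \<in> P; I a m\<rbrakk> \<Longrightarrow> fst f a = a" and fz: "fst f z = z"
    and l: "l \<in> L" "I (u U) l"
  shows "snd f l = l"
proof -
  have uU: "u U \<in> P" "I (u U) U" "U \<in> L" "I z U" using lines_zD[OF U] by auto
  have zm: "\<not> I z m" using colI[OF xP zP m(1,2)] znc by blast
  obtain V where V: "V \<in> lines_z" "V \<noteq> U" using other_line U by blast
  have vV: "u V \<in> P" "I (u V) V" "V \<in> L" "I z V" using lines_zD[OF V(1)] by auto
  have fV: "snd f V = V" using fix_lines_transfer[OF f xP zP znc fx fz vV(3,4)] .
  have "card {a\<in>P. I a V} = q + 1" using card_points[OF vV(3)] .
  moreover have "card {z, u V} \<le> 2" by (simp add: card_insert_if)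
  moreover have "q \<noteq> 1" "q \<noteq> 2" using q_gt q_odd by auto
  ultimately have "\<not> {a\<in>P. I a V} \<subseteq> {z, u V}" using card_mono[of "{z, u V}" "{a\<in>P. I a V}"] q_gt by auto
  then obtain a where a: "a \<in> P" "I a V" "a \<noteq> z" "a \<noteq> u V" by blast
  have xa: "\<not> col x a" using on_line_noncol[OF V(1) a(1,2,4)] .
  have am: "\<not> I a m" using colI[OF xP a(1) m(1,2)] xa by blast
  \<comment> \<open>The projection \<open>b\<close> is fixed because it lies on \<open>m\<close>; as
    \<open>a\<close> is in turn the projection of \<open>b\<close> onto the fixed line
    \<open>V\<close>, it is fixed too.\<close>
  define b where "b = pr m a"
  have b: "b \<in> P" "I b m" "col a b" unfolding b_def using proj_props[OF a(1) m(1) am] by auto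
  have bV: "\<not> I b V"
  proof
    assume bV: "I b V"
    have "b = u V"
      using proj_unique[OF xP vV(3) lines_zD(3)[OF V(1)] b(1) bV colI[OF xP b(1) m(1,2) b(2)]] .
    then have "u V = u U"
      using no_triangle[OF zP m(1) zm b(1,2) colI[OF zP b(1) vV(3,4) bV] uU(1) m(3)
          colI[OF zP uU(1,3,4,2)]] by simp
    then show False using u_not_on[OF U V(1) V(2)[symmetric]] vV(2) by simp
  qed
  have fb: "fst f b = b" using fm b by blast
  have "a = pr V b" using proj_unique[OF b(1) vV(3) bV a(1,2) col_sym[OF b(3)]] .
  then have fa: "fst f a = a" using proj_equivariant[OF f b(1) vV(3) bV] fb fV by simp
  have la: "snd f k = k" if "k \<in> L" "I a k" for k
    using fix_lines_transfer[OF f xP a(1) xa fx fa that] .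
  have uV: "\<not> I (u U) V" using u_not_on[OF U V(1) V(2)[symmetric]] .
  have "\<not> col a (u U)"
  proof
    assume "col a (u U)"
    then have "a = z"
      using no_triangle[OF uU(1) vV(3) uV a(1,2) col_sym zP vV(4) colI[OF uU(1) zP uU(3,2,4)]] by blast
    then show False using a(3) by blast
  qed
  then show ?thesis using fix_lines_transfer[OF f a(1) uU(1) _ la fm[OF uU(1) m(3)] l] by blast
qed

text \<open>An \<open>h\<close> fixing \<open>U\<close> is compared with an \<open>f\<close> from
  \<open>condM\<close> that agrees with it at \<open>z\<close>: \<open>rigidity\<close> applies to
  the inverse of \<open>h\<close> composed with \<open>f\<close>, so \<open>h\<close> fixes all
  lines on \<open>u U\<close>, as \<open>f\<close> does, and commutes with \<open>S\<close>.\<close>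

lemma condM_imp_central:
  assumes M: "condM P L I x"
  shows "S \<subseteq> center HG"
proof -
  have comm: "h \<otimes>\<^bsub>HG\<^esub> s = s \<otimes>\<^bsub>HG\<^esub> h" if U: "U \<in> lines_z" and h: "h \<in> stab_line H U" and s: "s \<in> S" for U h s
  proof (rule fixes_lines_commute[OF U h _ s])
    fix l assume l: "l \<in> L" "I (u U) l"
    have hH: "h \<in> H" "snd h U = U" using h unfolding stab_line_def by blast+
    note ha = H_aut[OF hH(1)]
    have uU: "u U \<in> P" "I (u U) U" "U \<in> L" "I z U" using lines_zD[OF U] by auto
    obtain m where m: "m \<in> L" "I x m" "I (u U) m" "m \<noteq> U" using axis_line[OF U] by blast
    have hz: "fst h z \<in> P" "I (fst h z) U"
      using aut_point[OF ha zP] aut_inc[OF ha zP uU(3)] hH(2) uU(4) by auto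
    have hu: "fst h (u U) = u U" using H_fix_u[OF U hH] .
    have hzu: "fst h z \<noteq> u U"
      using aut_inj_point[OF ha zP uU(1)] hu lines_zD(7)[OF U] by metis
    \<comment> \<open>The condition is used for the line \<open>m\<close>, its point
      \<open>u U\<close>, the line \<open>U\<close> on that point, and the points \<open>z\<close>
      and \<open>fst h z\<close> of \<open>U\<close>.\<close>
    obtain f where f: "f \<in> Aut P L I" "\<And>l. \<lbrakk>l \<in> L; I x l\<rbrakk> \<Longrightarrow> snd f l = l"
      "\<And>l. \<lbrakk>l \<in> L; I (u U) l\<rbrakk> \<Longrightarrow> snd f l = l" "\<And>a. \<lbrakk>a \<in> P; I a m\<rbrakk> \<Longrightarrow> fst f a = a"
      "fst f z = fst h z"
      using M[unfolded condM_def Let_def, rule_format, OF m(1,2) uU(1) m(3) lines_zD(8)[OF U]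
          uU(3) m(4)[symmetric] uU(2) zP hz(1) uU(4) lines_zD(7)[OF U, symmetric] hz(2) hzu] by blast
    define k where "k = inv\<^bsub>HG\<^esub> h"
    have k: "k \<in> H" unfolding k_def by (rule H_closed(2)[OF hH(1)])
    define e where "e = (fst k \<circ> fst f, snd k \<circ> snd f)"
    have e: "e \<in> Aut P L I" unfolding e_def by (rule aut_comp[OF H_aut[OF k] f(1)])
    have "fst k (u U) = u U"
      using inv_point(1)[OF hH(1), of "u U"] hu by (simp add: k_def)
    then have kst: "k \<in> stab_pt H (u U)" using k by (simp add: stab_pt_def)
    have "snd e l = l"
    proof (rule rigidity[OF U m(1-3) e _ _ _ l])
      show "snd e j = j" if "j \<in> L" "I x j" for j
        using f(2)[OF that] H_fix_lines[OF k that] by (simp add: e_def)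
      show "fst e a = a" if "a \<in> P" "I a m" for a
        using f(4)[OF that] stab_pt_fixes_axis[OF U m(1-3) kst that] by (simp add: e_def)
      show "fst e z = z" using f(5) inv_point(1)[OF hH(1)] by (simp add: e_def k_def)
    qed
    then have "snd k l = l" using f(3)[OF l] by (simp add: e_def)
    then have "snd h (snd k l) = snd h l" by simp
    then show "snd h l = l" unfolding k_def inv_line(2)[OF hH(1)] by (rule sym)
  qed
  show ?thesis
    unfolding center_S_iff
  proof
    fix s assume s: "s \<in> S"
    have sc: "s \<in> carrier HG" using s S_le_H by auto
    \<comment> \<open>The centralizer of \<open>s\<close> contains every line stabilizer, and these
      generate \<open>H\<close> by \<open>K.A_generate\<close>.\<close>
    let ?C = "{g \<in> carrier HG. g \<otimes>\<^bsub>HG\<^esub> s = s \<otimes>\<^bsub>HG\<^esub> g}"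
    have "subgroup ?C HG"
    proof (rule HG.subgroupI)
      show "?C \<noteq> {}" using sc by blast
      show "?C \<subseteq> carrier HG" by blast
      fix g assume g: "g \<in> ?C"
      then have gc: "g \<in> carrier HG" and gs: "g \<otimes>\<^bsub>HG\<^esub> s = s \<otimes>\<^bsub>HG\<^esub> g" by blast+
      note ig = HG.inv_closed[OF gc]
      have "inv\<^bsub>HG\<^esub> g \<otimes>\<^bsub>HG\<^esub> s = inv\<^bsub>HG\<^esub> g \<otimes>\<^bsub>HG\<^esub> (s \<otimes>\<^bsub>HG\<^esub> g \<otimes>\<^bsub>HG\<^esub> inv\<^bsub>HG\<^esub> g)"
        by (simp only: HG.m_assoc[OF sc gc ig] HG.r_inv[OF gc] HG.r_one[OF sc])
      also have "\<dots> = s \<otimes>\<^bsub>HG\<^esub> inv\<^bsub>HG\<^esub> g"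
        by (simp only: gs[symmetric] HG.m_assoc[OF gc sc ig] HG.inv_cancel_left[OF gc HG.m_closed[OF sc ig]])
      finally show "inv\<^bsub>HG\<^esub> g \<in> ?C" using ig by blast
      fix k assume k: "k \<in> ?C"
      then have kc: "k \<in> carrier HG" and ks: "k \<otimes>\<^bsub>HG\<^esub> s = s \<otimes>\<^bsub>HG\<^esub> k" by blast+
      have "g \<otimes>\<^bsub>HG\<^esub> k \<otimes>\<^bsub>HG\<^esub> s = s \<otimes>\<^bsub>HG\<^esub> (g \<otimes>\<^bsub>HG\<^esub> k)"
        by (simp only: HG.m_assoc[OF gc kc sc] ks HG.m_assoc[OF gc sc kc, symmetric] gs HG.m_assoc[OF sc gc kc])
      then show "g \<otimes>\<^bsub>HG\<^esub> k \<in> ?C" using HG.m_closed[OF gc kc] by blast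
    qed
    moreover have "stab_line H U \<subseteq> ?C" if "U \<in> lines_z" for U
      using comm[OF that _ s] HG.subgroup_closed(1)[OF subgroup_stab_line] by blast
    ultimately have C: "?C = carrier HG" by (rule K.A_generate)
    show "\<forall>g\<in>H. s \<otimes>\<^bsub>HG\<^esub> g = g \<otimes>\<^bsub>HG\<^esub> s"
    proof
      fix g assume "g \<in> H"
      then have "g \<in> carrier HG" by simp
      then have "g \<in> ?C" unfolding C .
      then have "g \<otimes>\<^bsub>HG\<^esub> s = s \<otimes>\<^bsub>HG\<^esub> g" by blast
      then show "s \<otimes>\<^bsub>HG\<^esub> g = g \<otimes>\<^bsub>HG\<^esub> s" by (rule sym)
    qed
  qed
qed

text \<open>The required automorphism is found in \<open>H\<close>. With \<open>a\<close> as base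
  point, \<open>y\<close> is the projection of \<open>x\<close> onto \<open>M\<close>; the
  stabilizer of \<open>M\<close> is transitive on the other points of \<open>M\<close>, fixes
  \<open>K\<close> pointwise by \<open>stab_pt_fixes_axis\<close>, and fixes all lines on
  \<open>y\<close> by \<open>central_S_fixes_lines\<close>.\<close>

lemma central_imp_condM:
  assumes c: "S \<subseteq> center HG"
  shows "condM P L I x"
  unfolding condM_def Let_def
proof (intro ballI impI)
  fix K y M a b
  assume K: "K \<in> L" "I x K" and y: "y \<in> P" "I y K" "y \<noteq> x" and M: "M \<in> L" "M \<noteq> K" "I y M"
    and a: "a \<in> P" and b: "b \<in> P" and aM: "I a M" "a \<noteq> y" and bM: "I b M" "b \<noteq> y"
  have xM: "\<not> I x M" using join_unique[OF xP y(1) y(3)[symmetric] M(1) K(1) _ M(3) K(2) y(2)] M(2) by blast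
  have xy: "col x y" using colI[OF xP y(1) K(1,2) y(2)] .
  have xa: "\<not> col x a"
    using no_triangle[OF xP M(1) xM a aM(1) _ y(1) M(3) xy] aM(2) by blast
  interpret R: skew_translation_gq P L I q x a H S
    using xa a stgq q_odd q_gt by unfold_locales auto
  have MR: "M \<in> R.lines_z" using M aM by (simp add: R.lines_z_def)
  have yM: "y = pr M x" using proj_unique[OF xP M(1) xM y(1) M(3) xy] .
  obtain h where h: "h \<in> stab_line H M" "fst h a = b"
    using R.stab_line_transitive[OF MR b bM(1)] bM(2) yM by blast
  have hH: "h \<in> H" "snd h M = M" using h(1) unfolding stab_line_def by blast+
  have "h \<in> stab_pt H (pr M x)" using R.H_fix_u[OF MR hH] hH(1) by (simp add: stab_pt_def)
  then have "fst h d = d" if "d \<in> P" "I d K" for d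
    using R.stab_pt_fixes_axis[OF MR K _ _ that] y(2) yM by blast
  moreover have "snd h l = l" if "l \<in> L" "I y l" for l
    using R.central_S_fixes_lines[OF c MR h(1) that(1)] that(2) yM by blast
  ultimately show "\<exists>h\<in>{h \<in> Aut P L I. (\<forall>l\<in>L. I x l \<longrightarrow> snd h l = l) \<and>
      (\<forall>l\<in>L. I y l \<longrightarrow> snd h l = l) \<and> (\<forall>a\<in>P. I a K \<longrightarrow> fst h a = a)}. fst h a = b"
    using H_aut[OF hH(1)] H_fix_lines[OF hH(1)] h(2) by blast
qed

end

theorem mainTheorem11:
  fixes P :: "'p set" and L :: "'l set" and I :: "'p \<Rightarrow> 'l \<Rightarrow> bool"
    and x z :: 'p and H S :: "('p,'l) autom set" and p q n :: nat
  assumes prime: "Factorial_Ring.prime p" and qpow: "q = p ^ n" and npos: "n \<ge> 1" and qodd: "odd q"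
    and stgq: "is_STGQ P L I q q x H S"
    and zP: "z \<in> P" and znc: "\<not> collinear P L I x z"
  defines "HG \<equiv> (AutGroup P L I)\<lparr>carrier := H\<rparr>"
  shows "((\<forall>A\<in>kantor_Fstar P L I x H z. comm_group (HG\<lparr>carrier := A\<rparr>)) \<longleftrightarrow> condM P L I x)
       \<and> (condM P L I x \<longleftrightarrow> special_group p HG \<and> group_exponent HG = p)
       \<and> (special_group p HG \<and> group_exponent HG = p \<longleftrightarrow> S \<subseteq> center HG)
       \<and> (S \<subseteq> center HG \<longleftrightarrow> S = center HG)"
proof -
  \<comment> \<open>This excludes the degenerate case of a trivial \<open>S\<close>.\<close>
  have "q \<noteq> 1" using qpow npos prime by (simp add: prime_nat_iff)
  then have q: "q > 1" using qodd by (metis even_zero less_one linorder_neqE_nat)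
  interpret R: skew_translation_gq P L I q x z H S
    using stgq qodd q zP znc
    by unfold_locales (auto simp: is_STGQ_def is_EGQ_def)
  \<comment> \<open>\<open>kantor_Fstar_eq\<close> turns the point stabilizers into the groups
    \<open>B\<close> of the abstract Kantor family.\<close>
  have "(\<forall>A\<in>kantor_Fstar P L I x H z. comm_group (HG\<lparr>carrier := A\<rparr>)) \<longleftrightarrow> S \<subseteq> center HG"
    unfolding R.kantor_Fstar_eq HG_def using R.K.B_abelian_iff by blast
  moreover have "condM P L I x \<longleftrightarrow> S \<subseteq> center HG"
    unfolding HG_def using R.condM_imp_central R.central_imp_condM by blast
  moreover have "special_group p HG \<and> group_exponent HG = p \<longleftrightarrow> S \<subseteq> center HG"
    unfolding HG_def by (rule R.K.special_iff_central[OF prime qpow])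
  moreover have "S \<subseteq> center HG \<longleftrightarrow> S = center HG"
    unfolding HG_def using R.K.center_eq_S by blast
  ultimately show ?thesis by blast
qed

end
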